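(* Let $|q|<1$ and let $\alpha,\beta,\gamma,\delta,e,f,g,h,t$ be complex numbers with $\beta,\delta,f,h,t\neq q^{-j}$ for all integers $j\ge 0$, such that all expressions below are well defined (no denominator vanishes and all the infinite series occurring converge absolutely). Then $$\begin{aligned} &\sum_{n=0}^{\infty}\frac{(\alpha)_{n}(\gamma)_{n}(e)_n(g)_n}{(\beta)_{n}(\delta)_{n}(f)_{n}(h)_n}t^n\\ &=\frac{(g,e,\gamma,\frac{\beta}{\alpha},q,\alpha t,\frac{q}{\alpha t},\frac{\delta q}{\beta},\frac{fq}{\beta},\frac{hq}{\beta})_{\infty}}{(h,f,\delta,\frac{q}{\alpha},\beta,\frac{\beta}{\alpha t},\frac{\alpha tq}{\beta},\frac{\gamma q}{\beta},\frac{eq}{\beta},\frac{gq}{\beta})_{\infty}}\;{}_{4}\phi_{3}\left(\begin{matrix}\frac{\alpha q}{\beta},\frac{\gamma q}{\beta},\frac{eq}{\beta},\frac{gq}{\beta}\\ \frac{\delta q}{\beta},\frac{fq}{\beta},\frac{hq}{\beta}\end{matrix};q,t\right)\\ &\quad+\left(1-\frac{q}{\beta}\right)\frac{(g,e,\gamma,t,\frac{\delta q}{\beta},\frac{fq}{\beta},\frac{hq}{\beta})_{\infty}}{(h,f,\delta,\frac{\alpha t}{\beta},\frac{\gamma q}{\beta},\frac{eq}{\beta},\frac{gq}{\beta})_{\infty}}\;{}_{4}\phi_{3}\left(\begin{matrix}\frac{\alpha q}{\beta},\frac{\gamma q}{\beta},\frac{eq}{\beta},\frac{gq}{\beta}\\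 \frac{\delta q}{\beta},\frac{fq}{\beta},\frac{hq}{\beta}\end{matrix};q,t\right)\left({}_{2}\phi_{1}\left(\begin{matrix}q,\frac{q}{t}\\ \frac{\beta q}{\alpha t}\end{matrix};q,\frac{q}{\alpha}\right)-1\right)\\ &\quad+\left(1-\frac{q}{\beta}\right)\frac{(g,e,\gamma,t,\frac{fq}{\beta},\frac{hq}{\beta})_{\infty}}{(h,f,\delta,\frac{\alpha t}{\beta},\frac{eq}{\beta},\frac{gq}{\beta})_{\infty}}\sum_{p=0}^{\infty}\frac{(\frac{\delta}{\gamma})_p(\frac{\alpha t}{\beta})_p\gamma^p}{(t)_p(q)_p}\sum_{k=0}^{\infty}\frac{(\frac{\delta q^p}{\gamma})_k(\frac{\gamma q}{\beta})^k}{(q^{p+1})_k}\;{}_{3}\phi_{2}\left(\begin{matrix}\frac{\alpha q}{\beta},\frac{eq}{\beta},\frac{gq}{\beta}\\ \frac{fq}{\beta},\frac{hq}{\beta}\end{matrix};q,tq^{p+k}\right)\\ &\quad+\left(1-\frac{q}{\beta}\right)\frac{(g,e,\gamma,t,\frac{hq}{\beta})_{\infty}}{(h,f,\delta,\frac{\alpha t}{\beta},\frac{gq}{\beta})_{\infty}}\sum_{p=1}^{\infty}\frac{(\frac{f}{e})_p(\frac{\alpha t}{\beta})_pe^p}{(t)_p(q)_p}\sum_{k=0}^{\infty}\frac{(\frac{\delta}{\gamma})_k(\frac{\alpha tq^p}{\beta})_k\gamma^k}{(q)_k(tq^{p})_k}\\ &\qquad\qquad\times\sum_{j=0}^{\infty}\frac{(\frac{fq^p}{e})_j(\frac{eq}{\beta})^j}{(q^{p+1})_j}\;{}_{2}\phi_{1}\left(\begin{matrix}\frac{\alpha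 q}{\beta},\frac{gq}{\beta}\\ \frac{hq}{\beta}\end{matrix};q,tq^{p+k+j}\right)\\ &\quad+\left(1-\frac{q}{\beta}\right)\frac{(g,e,\gamma)_{\infty}}{(h,f,\delta)_{\infty}}\sum_{p=1}^{\infty}\frac{(\frac{h}{g})_pg^p}{(q)_p}\sum_{j=0}^{\infty}\frac{(\frac{f}{e})_je^j}{(q)_j}\sum_{k=0}^{\infty}\frac{(\frac{\delta}{\gamma})_k\gamma^k}{(q)_k}\sum_{m=0}^{\infty}\frac{(\frac{hq^p}{g})_m(tq^{p+k+j})_m}{(q^{p+1})_m(\frac{\alpha tq^{p+k+j}}{\beta})_{m+1}}\left(\frac{gq}{\beta}\right)^{m}. \end{aligned}$$
   Context: For complex $A$ and $|q|<1$: $(A)_0=1$, $(A)_n=(A;q)_n=(1-A)(1-Aq)\cdots(1-Aq^{n-1})$ for positive integers $n$, and $(A)_\infty=(A;q)_\infty=\lim_{n\to\infty}(A;q)_n$. Also $(A_1,\dots,A_m)_\infty=(A_1)_\infty\cdots(A_m)_\infty$; all $q$-shifted factorials have base $q$. Expressions such as $(\frac{\gamma q}{\beta})^k$, $(\frac{eq}{\beta})^j$, $(\frac{gq}{\beta})^m$ are ordinary powers. The basic hypergeometric series is $${}_{r+1}\phi_{r}\left(\begin{matrix}a_1,\dots,a_{r+1}\\ b_1,\dots,b_r\end{matrix};q,z\right)=\sum_{n=0}^{\infty}\frac{(a_1)_n\cdots(a_{r+1})_n}{(q)_n(b_1)_n\cdots(b_r)_n}z^n.$$ Well-definedness means: $q\neq0$,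 every quantity appearing in a denominator (including $\alpha,\beta,\gamma,e,g,t$ and the $q$-shifted factorials in denominators) is nonzero, and every series converges absolutely, the nested sums being absolutely convergent as multiple series. *)

theory Defs
  imports "HOL-Analysis.Analysis"
begin

text \<open>
  \<open>HOL-Analysis\<close> contains two relations called \<open>abs_summable_on\<close> with the same infix syntax;
  this is the one belonging to \<open>infsum\<close>.
\<close>

abbreviation abs_conv_on :: "('a \<Rightarrow> complex) \<Rightarrow> 'a set \<Rightarrow> bool" (infixr "abs'_conv'_on" 46) where
  "f abs_conv_on A \<equiv> Infinite_Sum.abs_summable_on f A"

definition qpoch :: "complex \<Rightarrow> complex \<Rightarrow> nat \<Rightarrow> complex" where
  "qpoch q a n = (\<Prod>i<n. 1 - a * q ^ i)"

definition qpoch_inf :: "complex \<Rightarrow> complex \<Rightarrow> complex" where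
  "qpoch_inf q a = lim (\<lambda>n. qpoch q a n)"

definition qpochs :: "complex \<Rightarrow> complex list \<Rightarrow> nat \<Rightarrow> complex" where
  "qpochs q as n = (\<Prod>a\<leftarrow>as. qpoch q a n)"

definition qpochs_inf :: "complex \<Rightarrow> complex list \<Rightarrow> complex" where
  "qpochs_inf q as = (\<Prod>a\<leftarrow>as. qpoch_inf q a)"

text \<open>
  The basic hypergeometric series with upper parameters \<open>as\<close> and lower parameters \<open>bs\<close>. The formula
  is the usual one only if \<open>length as = length bs + 1\<close>; for other lengths the standard
  definition carries an additional power factor.

  Here, as in the unordered sums \<open>\<Sum>\<^sub>\<infinity>\<close> below, an absolutely convergent series has its usual value,
  and a series that does not converge absolutely has the junk value \<open>0\<close>. Convergence therefore
  has to be assumed separately, which is the purpose of \<open>qhyp_converges\<close>.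
\<close>

definition qhyp_term :: "complex \<Rightarrow> complex list \<Rightarrow> complex list \<Rightarrow> complex \<Rightarrow> nat \<Rightarrow> complex" where
  "qhyp_term q as bs z n = qpochs q as n / (qpoch q q n * qpochs q bs n) * z ^ n"

definition qhyp :: "complex \<Rightarrow> complex list \<Rightarrow> complex list \<Rightarrow> complex \<Rightarrow> complex" where
  "qhyp q as bs z = (\<Sum>\<^sub>\<infinity>n. qhyp_term q as bs z n)"

definition qhyp_converges :: "complex \<Rightarrow> complex list \<Rightarrow> complex list \<Rightarrow> complex \<Rightarrow> bool" where
  "qhyp_converges q as bs z \<longleftrightarrow> qhyp_term q as bs z abs_conv_on UNIV"

end

theory Submission
  imports Defs
begin

text \<open>
  The left-hand side is a superposition of rescalings of the simpler series with coefficients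
  \<open>(\<alpha>)\<^sub>n / (\<beta>)\<^sub>n\<close>. By the q-binomial theorem (\<open>q_binomial\<close>),
  \<open>(\<gamma>)\<^sub>n / (\<delta>)\<^sub>n\<close> is a power series in \<open>q ^ n\<close> with the coefficients
  \<open>(\<delta>/\<gamma>)\<^sub>k \<gamma>\<^sup>k / (q)\<^sub>k\<close>, up to a constant, and likewise for the pairs \<open>e\<close>, \<open>f\<close> and \<open>g\<close>, \<open>h\<close>. Hence
  the left-hand side is a constant times a weighted triple sum of the values \<open>F (k + j + s)\<close>, where
  \<open>F N = \<Sum>\<^sub>n (\<alpha>)\<^sub>n / (\<beta>)\<^sub>n (t q\<^sup>N)\<^sup>n\<close>.

  The series \<open>F\<close> satisfies a first-order inhomogeneous functional equation. Let
  \<open>\<Phi> N = (\<alpha> t q\<^sup>N\<^sup>+\<^sup>1 / \<beta>)\<^sub>\<infinity> / (t q\<^sup>N)\<^sub>\<infinity>\<close>, which by the q-binomial theorem is again a power series in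
  \<open>t q\<^sup>N\<close>. The quotient \<open>E = F / \<Phi>\<close> obeys the linear recursion
  \<open>E (N + 1) = (q / \<beta>) E N + (1 - q / \<beta>) \<kappa> (N + 1)\<close> with
  \<open>\<kappa> N = (t q\<^sup>N)\<^sub>\<infinity> / (\<alpha> t q\<^sup>N / \<beta>)\<^sub>\<infinity>\<close> (\<open>quotient_recursion\<close>). Unrolling it from \<open>k + j + s\<close> down to
  \<open>k + j\<close>, then to \<open>k\<close>, and finally to \<open>0\<close> yields three groups of inhomogeneous terms and a multiple
  of \<open>E 0\<close> (\<open>threefold_expansion\<close>). The groups are the quadruple sum, the triple sum and the
  terms with \<open>p \<ge> 1\<close> of the double sum. In the last two, the indices that are not unrolled are
  summed by means of the q-binomial theorem once more, which produces the \<open>2\<phi>1\<close> and the \<open>3\<phi>2\<close> series;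
  the \<open>4\<phi>3\<close> series is the factor of \<open>E 0\<close>.

  It remains to evaluate \<open>F 0\<close>, that is, to express it by an infinite product and a series in powers
  of \<open>q / \<alpha>\<close> (\<open>three_term_sum\<close>). This is an analytically continued form of Ramanujan's bilateral
  sum, and it accounts for the first two lines of the theorem. The proof follows the dependence on
  \<open>\<beta>\<close>: the difference of the two series satisfies a homogeneous relation under \<open>\<beta> \<mapsto> \<beta> q\<close>, so it is a
  product times its limit for \<open>\<beta> \<rightarrow> 0\<close>, and for generic \<open>\<alpha>\<close> and \<open>t\<close> the limit is found from the case
  \<open>\<beta> = q\<close>, which is the q-binomial theorem.

  All sums are unconditional, and the parameters may be such that some series terminate outside
  their discs of convergence. For this reason the lemmas assume the summability of particular
  series rather than bounds on the parameters.
\<close>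

section \<open>Unconditional sums of complex numbers\<close>

lemma summable_on_norm_complex:
  fixes f :: "'a \<Rightarrow> complex"
  shows "f summable_on A \<Longrightarrow> (\<lambda>x. norm (f x)) summable_on A"
  by (rule iffD1[OF summable_on_iff_abs_summable_on_complex])

lemma summable_on_comparison_complex:
  fixes f :: "'a \<Rightarrow> complex" and g :: "'a \<Rightarrow> complex"
  assumes "f summable_on A" and "\<And>x. x \<in> A \<Longrightarrow> norm (g x) \<le> K * norm (f x)"
  shows "g summable_on A"
proof -
  have "(\<lambda>x. norm (f x)) summable_on A"
    using assms(1) by (rule summable_on_norm_complex)
  then have "(\<lambda>x. K * norm (f x)) summable_on A"
    by (rule summable_on_cmult_right)
  then have "(\<lambda>x. norm (g x)) summable_on A"
    by (rule Infinite_Sum.abs_summable_on_comparison_test') (use assms(2) in auto)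
  then show ?thesis
    by (rule abs_summable_summable)
qed

lemma summable_on_mult_bounded:
  fixes f c :: "'a \<Rightarrow> complex"
  assumes "f summable_on A" and "\<And>x. x \<in> A \<Longrightarrow> norm (c x) \<le> K"
  shows "(\<lambda>x. f x * c x) summable_on A"
  using assms(1)
proof (rule summable_on_comparison_complex)
  fix x assume "x \<in> A"
  then show "norm (f x * c x) \<le> K * norm (f x)"
    using assms(2)[of x] by (simp add: norm_mult mult.commute mult_right_mono)
qed

lemma norm_infsum_complex_le:
  fixes f :: "'a \<Rightarrow> complex"
  assumes "f summable_on A"
  shows "norm (infsum f A) \<le> infsum (\<lambda>x. norm (f x)) A"
  by (intro norm_infsum_bound summable_on_norm_complex assms)

lemma norm_infsum_mult_bounded_le:
  fixes f c :: "'a \<Rightarrow> complex"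
  assumes f: "f summable_on A" and c: "\<And>x. x \<in> A \<Longrightarrow> norm (c x) \<le> K"
  shows "norm (\<Sum>\<^sub>\<infinity>x\<in>A. f x * c x) \<le> K * (\<Sum>\<^sub>\<infinity>x\<in>A. norm (f x))"
proof -
  have fc: "(\<lambda>x. f x * c x) summable_on A"
    using f c by (rule summable_on_mult_bounded)
  have nf: "(\<lambda>x. norm (f x)) summable_on A"
    using f by (rule summable_on_norm_complex)
  have "norm (\<Sum>\<^sub>\<infinity>x\<in>A. f x * c x) \<le> (\<Sum>\<^sub>\<infinity>x\<in>A. norm (f x * c x))"
    using fc by (rule norm_infsum_complex_le)
  also have "\<dots> \<le> (\<Sum>\<^sub>\<infinity>x\<in>A. K * norm (f x))"
  proof (rule infsum_mono)
    show "(\<lambda>x. norm (f x * c x)) summable_on A"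
      using fc by (rule summable_on_norm_complex)
    show "(\<lambda>x. K * norm (f x)) summable_on A"
      using nf by (rule summable_on_cmult_right)
    fix x assume "x \<in> A"
    then show "norm (f x * c x) \<le> K * norm (f x)"
      using c[of x] by (simp add: norm_mult mult.commute mult_right_mono)
  qed
  also have "\<dots> = K * (\<Sum>\<^sub>\<infinity>x\<in>A. norm (f x))"
    by (rule infsum_cmult_right')
  finally show ?thesis .
qed

lemma infsum_diff_complex:
  fixes f g :: "'a \<Rightarrow> complex"
  assumes "f summable_on A" "g summable_on A"
  shows "(\<lambda>x. f x - g x) summable_on A"
    and "(\<Sum>\<^sub>\<infinity>x\<in>A. f x - g x) = infsum f A - infsum g A"
proof -
  have g: "(\<lambda>x. - g x) summable_on A"
    using assms(2) by (simp add: summable_on_uminus)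
  show "(\<lambda>x. f x - g x) summable_on A"
    using summable_on_add[OF assms(1) g] by simp
  show "(\<Sum>\<^sub>\<infinity>x\<in>A. f x - g x) = infsum f A - infsum g A"
    using infsum_add[OF assms(1) g] by (simp add: infsum_uminus)
qed

lemma summable_on_times_complex:
  fixes f :: "'a \<Rightarrow> complex" and g :: "'b \<Rightarrow> complex"
  assumes f: "f summable_on A" and g: "g summable_on B"
  shows "(\<lambda>(x, y). f x * g y) summable_on A \<times> B"
proof -
  have nf: "(\<lambda>x. norm (f x)) summable_on A" and ng: "(\<lambda>x. norm (g x)) summable_on B"
    using f g by (auto intro: summable_on_norm_complex)
  have "(\<lambda>(x, y). norm (f x) * norm (g y)) summable_on A \<times> B"
  proof (rule summable_on_SigmaI)
    show "((\<lambda>y. case (x, y) of (x, y) \<Rightarrow> norm (f x) * norm (g y)) has_sum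
            (norm (f x) * (\<Sum>\<^sub>\<infinity>y\<in>B. norm (g y)))) B" for x
      using ng by (simp add: has_sum_cmult_right)
    show "(\<lambda>x. norm (f x) * (\<Sum>\<^sub>\<infinity>y\<in>B. norm (g y))) summable_on A"
      using nf by (rule summable_on_cmult_left)
  qed auto
  then have "(\<lambda>z. norm ((\<lambda>(x, y). f x * g y) z)) summable_on A \<times> B"
    by (simp add: case_prod_unfold norm_mult)
  then show ?thesis
    by (rule abs_summable_summable)
qed

lemma infsum_reverse_three:
  fixes f :: "'a \<Rightarrow> 'b \<Rightarrow> 'c \<Rightarrow> complex"
  assumes "(\<lambda>(x, y, z). f x y z) summable_on A \<times> B \<times> C"
  shows "(\<Sum>\<^sub>\<infinity>x\<in>A. \<Sum>\<^sub>\<infinity>y\<in>B. \<Sum>\<^sub>\<infinity>z\<in>C. f x y z) = (\<Sum>\<^sub>\<infinity>z\<in>C. \<Sum>\<^sub>\<infinity>y\<in>B. \<Sum>\<^sub>\<infinity>x\<in>A. f x y z)"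
proof -
  have *: "(\<Sum>\<^sub>\<infinity>x\<in>A. \<Sum>\<^sub>\<infinity>y\<in>B. \<Sum>\<^sub>\<infinity>z\<in>C. g x y z) = infsum (\<lambda>(x, y, z). g x y z) (A \<times> B \<times> C)"
    if g: "(\<lambda>(x, y, z). g x y z) summable_on A \<times> B \<times> C"
    for A :: "'x set" and B :: "'y set" and C :: "'z set" and g :: "'x \<Rightarrow> 'y \<Rightarrow> 'z \<Rightarrow> complex"
  proof -
    have "(\<Sum>\<^sub>\<infinity>y\<in>B. \<Sum>\<^sub>\<infinity>z\<in>C. g x y z) = (\<Sum>\<^sub>\<infinity>(y, z)\<in>B \<times> C. g x y z)" if "x \<in> A" for x
    proof -
      have "(\<lambda>(y, z). g x y z) summable_on B \<times> C"
        using summable_on_SigmaD1[of "\<lambda>x (y, z). g x y z" A "\<lambda>_. B \<times> C" x] g that by simp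
      then show ?thesis
        using infsum_Sigma'_banach[of "\<lambda>y z. g x y z" B "\<lambda>_. C"] by simp
    qed
    then have "(\<Sum>\<^sub>\<infinity>x\<in>A. \<Sum>\<^sub>\<infinity>y\<in>B. \<Sum>\<^sub>\<infinity>z\<in>C. g x y z) = (\<Sum>\<^sub>\<infinity>x\<in>A. \<Sum>\<^sub>\<infinity>(y, z)\<in>B \<times> C. g x y z)"
      by (rule infsum_cong)
    also have "\<dots> = infsum (\<lambda>(x, y, z). g x y z) (A \<times> B \<times> C)"
      using infsum_Sigma'_banach[of "\<lambda>x (y, z). g x y z" A "\<lambda>_. B \<times> C"] g by simp
    finally show ?thesis .
  qed
  have bij: "bij_betw (\<lambda>(z, y, x). (x, y, z)) (C \<times> B \<times> A) (A \<times> B \<times> C)"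
    by (rule bij_betwI[of _ _ _ "\<lambda>(x, y, z). (z, y, x)"]) auto
  have s: "(\<lambda>(z, y, x). f x y z) summable_on C \<times> B \<times> A"
    using summable_on_reindex_bij_betw[OF bij, of "\<lambda>(x, y, z). f x y z"] assms
    by (simp add: case_prod_unfold)
  have "infsum (\<lambda>(x, y, z). f x y z) (A \<times> B \<times> C) = infsum (\<lambda>(z, y, x). f x y z) (C \<times> B \<times> A)"
    using infsum_reindex_bij_betw[OF bij, of "\<lambda>(x, y, z). f x y z"]
    by (simp add: case_prod_unfold)
  with *[OF assms] *[OF s] show ?thesis by simp
qed

text \<open>
  Both sides run over the pairs \<open>1 \<le> i \<le> n\<close>: on the left row by row for fixed \<open>n\<close>, on the right
  with \<open>m = n - i\<close> as the second index.
\<close>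

lemma infsum_triangle:
  fixes a :: "nat \<Rightarrow> nat \<Rightarrow> complex"
  assumes "(\<lambda>(i, m). a i m) summable_on {1..} \<times> UNIV"
  shows "(\<lambda>n. \<Sum>i=1..n. a i (n - i)) summable_on UNIV"
    and "(\<Sum>\<^sub>\<infinity>n. \<Sum>i=1..n. a i (n - i)) = (\<Sum>\<^sub>\<infinity>i\<in>{1..}. \<Sum>\<^sub>\<infinity>m. a i m)"
proof -
  have bij: "bij_betw (\<lambda>(n, i). (i, n - i)) (SIGMA n:UNIV. {1..n}) ({1..} \<times> (UNIV :: nat set))"
    by (rule bij_betwI[of _ _ _ "\<lambda>(i, m). (i + m, i)"]) auto
  have s: "(\<lambda>(n, i). a i (n - i)) summable_on (SIGMA n:UNIV. {1..n})"
    using summable_on_reindex_bij_betw[OF bij, of "\<lambda>(i, m). a i m"] assms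
    by (simp add: case_prod_unfold)
  show "(\<lambda>n. \<Sum>i=1..n. a i (n - i)) summable_on UNIV"
    using summable_on_Sigma_banach[OF s] by simp
  have "(\<Sum>\<^sub>\<infinity>n. \<Sum>i=1..n. a i (n - i)) = (\<Sum>\<^sub>\<infinity>(n, i)\<in>(SIGMA n:UNIV. {1..n}). a i (n - i))"
    using infsum_Sigma'_banach[OF s] by simp
  also have "\<dots> = (\<Sum>\<^sub>\<infinity>(i, m)\<in>{1..} \<times> UNIV. a i m)"
    using infsum_reindex_bij_betw[OF bij, of "\<lambda>(i, m). a i m"] by (simp add: case_prod_unfold)
  also have "\<dots> = (\<Sum>\<^sub>\<infinity>i\<in>{1..}. \<Sum>\<^sub>\<infinity>m. a i m)"
    using infsum_Sigma'_banach[OF assms] by simp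
  finally show "(\<Sum>\<^sub>\<infinity>n. \<Sum>i=1..n. a i (n - i)) = (\<Sum>\<^sub>\<infinity>i\<in>{1..}. \<Sum>\<^sub>\<infinity>m. a i m)" .
qed

lemma summable_on_nat_from_1:
  fixes f :: "nat \<Rightarrow> complex"
  assumes "f summable_on {1..}"
  shows "f summable_on UNIV"
proof -
  have "insert 0 {1..} = (UNIV :: nat set)"
    by auto
  then show ?thesis
    using assms summable_on_insert_iff[of f 0 "{1..}"] by simp
qed

lemma infsum_nat_split_first:
  fixes f :: "nat \<Rightarrow> complex"
  assumes "f summable_on UNIV"
  shows "infsum f UNIV = f 0 + (\<Sum>\<^sub>\<infinity>n. f (Suc n))"
    and "(\<lambda>n. f (Suc n)) summable_on UNIV"
    and "infsum f UNIV = f 0 + infsum f {1..}"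
proof -
  have bij: "bij_betw Suc UNIV {1..}"
    by (rule bij_betwI[of _ _ _ "\<lambda>n. n - 1"]) auto
  have s: "f summable_on {1..}"
    using assms by (rule summable_on_subset_banach) auto
  then show "(\<lambda>n. f (Suc n)) summable_on UNIV"
    using summable_on_reindex_bij_betw[OF bij, of f] by simp
  have "(UNIV :: nat set) = insert 0 {1..}"
    by auto
  then show *: "infsum f UNIV = f 0 + infsum f {1..}"
    using infsum_insert[OF s, of 0] by simp
  then show "infsum f UNIV = f 0 + (\<Sum>\<^sub>\<infinity>n. f (Suc n))"
    using infsum_reindex_bij_betw[OF bij, of f] by simp
qed

section \<open>Convergence of shifted factorials\<close>

lemma qpoch_0 [simp]: "qpoch q a 0 = 1"
  by (simp add: qpoch_def)

lemma qpoch_Suc: "qpoch q a (Suc n) = qpoch q a n * (1 - a * q ^ n)"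
  by (simp add: qpoch_def)

lemma qpoch_add: "qpoch q a (m + n) = qpoch q a m * qpoch q (a * q ^ m) n"
  by (induction n) (simp_all add: qpoch_Suc power_add mult.assoc)

lemma qpoch_Suc_left: "qpoch q a (Suc n) = (1 - a) * qpoch q (a * q) n"
  using qpoch_add[of q a 1 n] by (simp add: qpoch_Suc)

text \<open>
  Since \<open>a * q ^ i\<close> decays geometrically, the infinite product converges absolutely, and such a
  product vanishes only if one of its factors does.
\<close>

lemma qpoch_tendsto:
  assumes "norm q < 1"
  shows "qpoch q a \<longlonglongrightarrow> qpoch_inf q a"
    and "(\<And>n. qpoch q a n \<noteq> 0) \<Longrightarrow> qpoch_inf q a \<noteq> 0"
proof -
  have "summable (\<lambda>i. norm (a * q ^ i))"
    using assms by (simp add: norm_mult norm_power summable_mult summable_geometric)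
  then have "abs_convergent_prod (\<lambda>i. 1 - a * q ^ i)"
    unfolding abs_convergent_prod_conv_summable by simp
  then have conv: "convergent_prod (\<lambda>i. 1 - a * q ^ i)"
    by (rule abs_convergent_prod_imp_convergent_prod)
  define L where "L = prodinf (\<lambda>i. 1 - a * q ^ i)"
  have "(\<lambda>n. qpoch q a (Suc n)) \<longlonglongrightarrow> L"
    using convergent_prod_LIMSEQ[OF conv] by (simp add: qpoch_def L_def lessThan_Suc_atMost)
  then have L: "qpoch q a \<longlonglongrightarrow> L"
    by (simp only: filterlim_sequentially_Suc)
  then have eq: "qpoch_inf q a = L"
    unfolding qpoch_inf_def by (rule limI)
  then show "qpoch q a \<longlonglongrightarrow> qpoch_inf q a"
    using L by simp
  show "qpoch_inf q a \<noteq> 0" if nz: "\<And>n. qpoch q a n \<noteq> 0"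
  proof -
    have "1 - a * q ^ i \<noteq> 0" for i
      using nz[of "Suc i"] by (simp add: qpoch_Suc)
    then show ?thesis
      unfolding eq L_def by (rule prodinf_nonzero[OF conv])
  qed
qed

lemma qpoch_inf_split:
  assumes "norm q < 1"
  shows "qpoch_inf q a = qpoch q a n * qpoch_inf q (a * q ^ n)"
proof (rule LIMSEQ_unique)
  show "(\<lambda>m. qpoch q a (n + m)) \<longlonglongrightarrow> qpoch_inf q a"
    using LIMSEQ_ignore_initial_segment[OF qpoch_tendsto(1)[OF assms], of a n]
    by (simp add: add.commute)
  show "(\<lambda>m. qpoch q a (n + m)) \<longlonglongrightarrow> qpoch q a n * qpoch_inf q (a * q ^ n)"
    unfolding qpoch_add using qpoch_tendsto(1)[OF assms] by (rule tendsto_mult_left)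
qed

lemma qpoch_inf_split_first:
  assumes "norm q < 1"
  shows "qpoch_inf q a = (1 - a) * qpoch_inf q (a * q)"
  using qpoch_inf_split[OF assms, of a 1] by (simp add: qpoch_Suc)

lemma qpoch_nonzero_if_inf:
  assumes "norm q < 1" "qpoch_inf q a \<noteq> 0"
  shows "qpoch q a n \<noteq> 0" and "qpoch_inf q (a * q ^ n) \<noteq> 0"
  using qpoch_inf_split[OF assms(1), of a n] assms(2) by auto

lemma qpoch_inf_shift:
  assumes "norm q < 1" "qpoch_inf q a \<noteq> 0"
  shows "qpoch_inf q (a * q ^ n) = qpoch_inf q a / qpoch q a n"
  using qpoch_inf_split[OF assms(1), of a n] qpoch_nonzero_if_inf(1)[OF assms, of n]
  by (simp add: field_simps)

lemma qpoch_bounded: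
  assumes "norm q < 1"
  obtains K where "\<And>n. norm (qpoch q a n) \<le> K"
proof -
  have "Bseq (qpoch q a)"
    using qpoch_tendsto(1)[OF assms] by (intro convergent_imp_Bseq convergentI)
  then show ?thesis
    using that by (auto simp: Bseq_def)
qed

lemma inverse_qpoch_bounded:
  assumes "norm q < 1" "\<And>n. qpoch q a n \<noteq> 0"
  obtains K where "\<And>n. norm (1 / qpoch q a n) \<le> K"
proof -
  have "(\<lambda>n. 1 / qpoch q a n) \<longlonglongrightarrow> 1 / qpoch_inf q a"
    using qpoch_tendsto(1)[OF assms(1)] qpoch_tendsto(2)[OF assms] by (intro tendsto_intros) auto
  then have "Bseq (\<lambda>n. 1 / qpoch q a n)"
    by (intro convergent_imp_Bseq convergentI)
  then show ?thesis
    using that by (auto simp: Bseq_def)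
qed

text \<open>
  Quotients of shifted factorials stay bounded, and so do their reciprocals if no factor vanishes.
  They may therefore be inserted into a series, or cancelled from it, without affecting its
  convergence.
\<close>

lemma qpoch_ratio_bounded:
  assumes "norm q < 1" "\<And>n. qpoch q b n \<noteq> 0"
  obtains K where "\<And>n. norm (qpoch q a n / qpoch q b n) \<le> K"
proof -
  obtain K1 where K1: "\<And>n. norm (qpoch q a n) \<le> K1"
    using qpoch_bounded[OF assms(1)] by blast
  obtain K2 where K2: "\<And>n. norm (1 / qpoch q b n) \<le> K2"
    using inverse_qpoch_bounded[OF assms] by blast
  have "norm (qpoch q a n / qpoch q b n) \<le> K1 * K2" for n
  proof -
    have "norm (qpoch q a n / qpoch q b n) = norm (qpoch q a n) * norm (1 / qpoch q b n)"
      by (simp add: norm_divide)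
    also have "\<dots> \<le> K1 * K2"
      using K1[of n] K2[of n] by (intro mult_mono) (auto intro: order_trans[OF norm_ge_zero])
    finally show ?thesis .
  qed
  then show ?thesis using that by blast
qed

section \<open>Power series with geometrically shrinking arguments\<close>

definition psum :: "(nat \<Rightarrow> complex) \<Rightarrow> complex \<Rightarrow> complex" where
  "psum V z = (\<Sum>\<^sub>\<infinity>n. V n * z ^ n)"

lemma psum_shrink_summable:
  fixes V :: "nat \<Rightarrow> complex"
  assumes "(\<lambda>n. V n * z ^ n) summable_on UNIV" "norm c \<le> 1"
  shows "(\<lambda>n. V n * (z * c) ^ n) summable_on UNIV"
proof -
  have "(\<lambda>n. V n * z ^ n * c ^ n) summable_on UNIV"
    using assms(1) by (rule summable_on_mult_bounded[where K = 1])
      (use assms(2) in \<open>simp add: norm_power power_le_one\<close>)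
  then show ?thesis
    by (simp add: power_mult_distrib mult.assoc)
qed

lemma psum_shrink_bound:
  assumes "(\<lambda>n. V n * z ^ n) summable_on UNIV" "norm c \<le> 1"
  shows "norm (psum V (z * c)) \<le> (\<Sum>\<^sub>\<infinity>n. norm (V n * z ^ n))"
proof -
  have "psum V (z * c) = (\<Sum>\<^sub>\<infinity>n. V n * z ^ n * c ^ n)"
    by (simp add: psum_def power_mult_distrib mult.assoc)
  also have "norm \<dots> \<le> 1 * (\<Sum>\<^sub>\<infinity>n. norm (V n * z ^ n))"
    using assms(1) by (rule norm_infsum_mult_bounded_le)
      (use assms(2) in \<open>simp add: norm_power power_le_one\<close>)
  finally show ?thesis by simp
qed

lemma psum_tendsto:
  assumes "norm q < 1" "(\<lambda>n. V n * z ^ n) summable_on UNIV"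
  shows "(\<lambda>N. psum V (z * q ^ N)) \<longlonglongrightarrow> V 0"
proof -
  define K where "K = (\<Sum>\<^sub>\<infinity>n. norm (V (Suc n) * z ^ Suc n))"
  have s: "(\<lambda>n. V (Suc n) * z ^ Suc n) summable_on UNIV"
    using infsum_nat_split_first(2)[OF assms(2)] by simp
  have "norm (psum V (z * q ^ N) - V 0) \<le> norm q ^ N * K" for N
  proof -
    have "(\<lambda>n. V n * (z * q ^ N) ^ n) summable_on UNIV"
      using assms by (intro psum_shrink_summable) (auto simp: norm_power power_le_one)
    then have "psum V (z * q ^ N) - V 0 = (\<Sum>\<^sub>\<infinity>n. V (Suc n) * (z * q ^ N) ^ Suc n)"
      using infsum_nat_split_first(1) by (simp add: psum_def)
    also have "\<dots> = (\<Sum>\<^sub>\<infinity>n. V (Suc n) * z ^ Suc n * (q ^ N) ^ Suc n)"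
      by (simp add: power_mult_distrib mult_ac)
    also have "norm \<dots> \<le> norm q ^ N * K"
      unfolding K_def using s
    proof (rule norm_infsum_mult_bounded_le)
      fix n
      have "norm ((q ^ N) ^ Suc n) = norm q ^ N * (norm q ^ N) ^ n"
        by (simp add: norm_mult norm_power)
      also have "\<dots> \<le> norm q ^ N"
        using assms(1) by (simp add: power_le_one mult_left_le)
      finally show "norm ((q ^ N) ^ Suc n) \<le> norm q ^ N" .
    qed
    finally show ?thesis .
  qed
  moreover have "(\<lambda>N. norm q ^ N * K) \<longlonglongrightarrow> 0"
    using assms(1) by (auto intro!: tendsto_mult_left_zero[OF LIMSEQ_power_zero])
  ultimately have "(\<lambda>N. psum V (z * q ^ N) - V 0) \<longlonglongrightarrow> 0"
    by (rule Lim_null_comparison[OF always_eventually[OF allI]])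
  then show ?thesis
    by (simp add: LIM_zero_iff)
qed

text \<open>
  The mechanism behind every rearrangement below: averaging a power series over the points
  \<open>z * q ^ (M + s)\<close> with weights \<open>W s * y ^ s\<close> multiplies its \<open>n\<close>-th coefficient by the value of the
  weight series at \<open>y * q ^ n\<close>. The double series is dominated by the product of the two given
  ones, because powers of \<open>q\<close> have norm at most 1.
\<close>

lemma psum_of_psums:
  assumes q: "norm q < 1"
    and W: "(\<lambda>s. W s * y ^ s) summable_on UNIV"
    and V: "(\<lambda>n. V n * z ^ n) summable_on UNIV"
  shows "(\<Sum>\<^sub>\<infinity>s. W s * y ^ s * psum V (z * q ^ (M + s)))
           = psum (\<lambda>n. V n * psum W (y * q ^ n)) (z * q ^ M)"
    and "(\<lambda>s. W s * y ^ s * psum V (z * q ^ (M + s))) summable_on UNIV"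
    and "(\<lambda>n. V n * psum W (y * q ^ n) * z ^ n) summable_on UNIV"
proof -
  have pow: "norm (q ^ n) \<le> 1" for n
    using q by (simp add: norm_power power_le_one)
  define h where "h s n = W s * y ^ s * (V n * z ^ n) * q ^ ((M + s) * n)" for s n
  have h: "(\<lambda>(s, n). h s n) summable_on UNIV \<times> UNIV"
    using summable_on_mult_bounded[OF summable_on_times_complex[OF W V],
        of "\<lambda>(s, n). q ^ ((M + s) * n)" 1] pow
    by (simp add: h_def case_prod_unfold)
  have in_n: "(\<Sum>\<^sub>\<infinity>n. h s n) = W s * y ^ s * psum V (z * q ^ (M + s))" for s
  proof -
    have "(\<Sum>\<^sub>\<infinity>n. h s n) = (\<Sum>\<^sub>\<infinity>n. W s * y ^ s * (V n * (z * q ^ (M + s)) ^ n))"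
      unfolding h_def power_mult_distrib power_mult by (simp only: mult_ac)
    then show ?thesis
      by (simp add: psum_def infsum_cmult_right')
  qed
  have in_s: "(\<Sum>\<^sub>\<infinity>s. h s n) = V n * psum W (y * q ^ n) * (z * q ^ M) ^ n" for n
  proof -
    have "h s n = V n * (z * q ^ M) ^ n * (W s * (y * q ^ n) ^ s)" for s
      by (simp add: h_def power_mult_distrib power_mult[symmetric] power_add algebra_simps)
    then have "(\<Sum>\<^sub>\<infinity>s. h s n) = V n * (z * q ^ M) ^ n * psum W (y * q ^ n)"
      by (simp only: psum_def infsum_cmult_right')
    then show ?thesis
      by (simp only: mult_ac)
  qed
  show "(\<Sum>\<^sub>\<infinity>s. W s * y ^ s * psum V (z * q ^ (M + s)))
           = psum (\<lambda>n. V n * psum W (y * q ^ n)) (z * q ^ M)"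
    using infsum_swap_banach[OF h] unfolding in_n in_s by (simp add: psum_def)
  show "(\<lambda>s. W s * y ^ s * psum V (z * q ^ (M + s))) summable_on UNIV"
    using summable_on_Sigma_banach[OF h] unfolding in_n by simp
  show "(\<lambda>n. V n * psum W (y * q ^ n) * z ^ n) summable_on UNIV"
  proof -
    have "(\<lambda>n. V n * z ^ n * psum W (y * q ^ n)) summable_on UNIV"
      using V psum_shrink_bound[OF W pow] by (rule summable_on_mult_bounded)
    then show ?thesis by (simp add: mult_ac)
  qed
qed

section \<open>The q-binomial theorem\<close>

definition qcoeff :: "complex \<Rightarrow> complex \<Rightarrow> nat \<Rightarrow> complex" where
  "qcoeff q a n = qpoch q a n / qpoch q q n"

lemma qpoch_q_nonzero:
  assumes "norm q < 1"
  shows "qpoch q q n \<noteq> 0"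
proof -
  have "1 - q * q ^ i \<noteq> 0" for i
  proof
    assume "1 - q * q ^ i = 0"
    then have "norm (q ^ Suc i) = 1" by simp
    moreover have "norm q * norm q ^ i \<le> norm q * 1"
      using assms by (intro mult_left_mono power_le_one) auto
    then have "norm (q ^ Suc i) < 1"
      using assms by (simp add: norm_mult norm_power)
    ultimately show False by simp
  qed
  then show ?thesis by (simp add: qpoch_def)
qed

text \<open>
  The series \<open>F\<close> satisfies \<open>(1 - w) * F w = (1 - a * w) * F (w * q)\<close> by the recursion for its
  coefficients. Iterating moves the argument to 0, where \<open>F\<close> equals 1. Only summability at \<open>z\<close> is
  assumed instead of \<open>norm z < 1\<close>, which covers terminating series at arbitrary arguments as well.
\<close>

lemma q_binomial:
  assumes q: "norm q < 1" and s: "(\<lambda>n. qcoeff q a n * z ^ n) summable_on UNIV"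
  shows "qpoch_inf q z * psum (qcoeff q a) z = qpoch_inf q (a * z)"
proof -
  let ?f = "psum (qcoeff q a)"
  have step: "(1 - w) * ?f w = (1 - a * w) * ?f (w * q)"
    if w: "(\<lambda>n. qcoeff q a n * w ^ n) summable_on UNIV" for w
  proof -
    have wq: "(\<lambda>n. qcoeff q a n * (w * q) ^ n) summable_on UNIV"
      using w q by (intro psum_shrink_summable) auto
    have rec: "qcoeff q a (Suc n) * (1 - q ^ Suc n) = qcoeff q a n * (1 - a * q ^ n)" for n
      using qpoch_q_nonzero[OF q, of "Suc n"] qpoch_q_nonzero[OF q, of n]
      by (simp add: qcoeff_def qpoch_Suc field_simps)
    have "?f w - ?f (w * q) = (\<Sum>\<^sub>\<infinity>n. qcoeff q a n * w ^ n - qcoeff q a n * (w * q) ^ n)"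
      unfolding psum_def by (rule infsum_diff_complex(2)[symmetric, OF w wq])
    also have "\<dots> = (\<Sum>\<^sub>\<infinity>n. qcoeff q a (Suc n) * w ^ Suc n - qcoeff q a (Suc n) * (w * q) ^ Suc n)"
      using infsum_nat_split_first(1)[OF infsum_diff_complex(1)[OF w wq]] by simp
    also have "\<dots> = (\<Sum>\<^sub>\<infinity>n. w * (qcoeff q a n * w ^ n) - w * a * (qcoeff q a n * (w * q) ^ n))"
    proof (rule infsum_cong)
      fix n
      have "qcoeff q a (Suc n) * w ^ Suc n - qcoeff q a (Suc n) * (w * q) ^ Suc n
              = w ^ Suc n * (qcoeff q a (Suc n) * (1 - q ^ Suc n))"
        by (simp add: power_mult_distrib algebra_simps)
      also have "\<dots> = w * (qcoeff q a n * w ^ n) - w * a * (qcoeff q a n * (w * q) ^ n)"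
        unfolding rec by (simp add: power_mult_distrib algebra_simps)
      finally show "qcoeff q a (Suc n) * w ^ Suc n - qcoeff q a (Suc n) * (w * q) ^ Suc n
         = w * (qcoeff q a n * w ^ n) - w * a * (qcoeff q a n * (w * q) ^ n)" .
    qed
    also have "\<dots> = (\<Sum>\<^sub>\<infinity>n. w * (qcoeff q a n * w ^ n)) - (\<Sum>\<^sub>\<infinity>n. w * a * (qcoeff q a n * (w * q) ^ n))"
      using w wq by (intro infsum_diff_complex(2) summable_on_cmult_right)
    also have "\<dots> = w * ?f w - w * a * ?f (w * q)"
      by (simp only: infsum_cmult_right' psum_def)
    finally show ?thesis by (simp add: algebra_simps)
  qed
  have iter: "qpoch q z n * ?f z = qpoch q (a * z) n * ?f (z * q ^ n)" for n
  proof (induction n)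
    case (Suc n)
    have "(\<lambda>k. qcoeff q a k * (z * q ^ n) ^ k) summable_on UNIV"
      using s q by (intro psum_shrink_summable) (auto simp: norm_power power_le_one)
    from step[OF this]
    have st: "(1 - z * q ^ n) * ?f (z * q ^ n) = (1 - a * z * q ^ n) * ?f (z * q ^ Suc n)"
      by (simp add: mult_ac)
    have "qpoch q z (Suc n) * ?f z = (1 - z * q ^ n) * (qpoch q z n * ?f z)"
      by (simp add: qpoch_Suc mult_ac)
    also have "\<dots> = qpoch q (a * z) n * ((1 - z * q ^ n) * ?f (z * q ^ n))"
      unfolding Suc.IH by (simp add: mult_ac)
    also have "\<dots> = qpoch q (a * z) (Suc n) * ?f (z * q ^ Suc n)"
      unfolding st by (simp add: qpoch_Suc mult_ac)
    finally show ?case .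
  qed simp
  show ?thesis
  proof (rule LIMSEQ_unique)
    show "(\<lambda>n. qpoch q z n * ?f z) \<longlonglongrightarrow> qpoch_inf q z * ?f z"
      using qpoch_tendsto(1)[OF q] by (intro tendsto_intros)
    have "(\<lambda>n. qpoch q (a * z) n * ?f (z * q ^ n)) \<longlonglongrightarrow> qpoch_inf q (a * z) * qcoeff q a 0"
      using qpoch_tendsto(1)[OF q] psum_tendsto[OF q s] by (rule tendsto_mult)
    then show "(\<lambda>n. qpoch q z n * ?f z) \<longlonglongrightarrow> qpoch_inf q (a * z)"
      unfolding iter by (simp add: qcoeff_def)
  qed
qed

text \<open>
  If \<open>z = q ^ (- j)\<close>, then the left-hand side of the q-binomial theorem vanishes and the right-hand
  side must vanish too. This is how the convergence of an expansion excludes zero prefactors.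
\<close>

lemma q_binomial_nonzero:
  assumes "norm q < 1" "(\<lambda>n. qcoeff q a n * z ^ n) summable_on UNIV" "qpoch_inf q (a * z) \<noteq> 0"
  shows "qpoch_inf q z \<noteq> 0"
  using q_binomial[OF assms(1,2)] assms(3) by auto

lemma q_binomial_shifted:
  assumes q: "norm q < 1" and s: "(\<lambda>n. qcoeff q a n * z ^ n) summable_on UNIV"
    and nz: "qpoch_inf q z \<noteq> 0" "\<And>n. qpoch q (a * z) n \<noteq> 0"
  shows "psum (qcoeff q a) (z * q ^ n)
           = qpoch_inf q (a * z) / qpoch_inf q z * (qpoch q z n / qpoch q (a * z) n)"
proof -
  have "(\<lambda>k. qcoeff q a k * (z * q ^ n) ^ k) summable_on UNIV"
    using s q by (intro psum_shrink_summable) (auto simp: norm_power power_le_one)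
  from q_binomial[OF q this]
  have "qpoch_inf q (z * q ^ n) * psum (qcoeff q a) (z * q ^ n) = qpoch_inf q (a * z * q ^ n)"
    by (simp add: mult_ac)
  moreover have "qpoch_inf q (z * q ^ n) \<noteq> 0"
    by (rule qpoch_nonzero_if_inf(2)[OF q nz(1)])
  ultimately have "psum (qcoeff q a) (z * q ^ n) = qpoch_inf q (a * z * q ^ n) / qpoch_inf q (z * q ^ n)"
    by (simp add: nonzero_eq_divide_eq mult.commute)
  also have "qpoch_inf q (a * z * q ^ n) = qpoch_inf q (a * z) / qpoch q (a * z) n"
    using qpoch_inf_split[OF q, of "a * z" n] nz(2)[of n] by (simp add: nonzero_eq_divide_eq mult.commute)
  also have "qpoch_inf q (z * q ^ n) = qpoch_inf q z / qpoch q z n"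
    by (rule qpoch_inf_shift[OF q nz(1)])
  finally show ?thesis
    by simp
qed

section \<open>A three-term form of Ramanujan's bilateral sum\<close>

definition qratio :: "complex \<Rightarrow> complex \<Rightarrow> complex \<Rightarrow> nat \<Rightarrow> complex" where
  "qratio q a b n = qpoch q a n / qpoch q b n"

lemma qratio_summable_shift:
  assumes q: "norm q < 1" and b: "\<And>n. qpoch q b n \<noteq> 0"
    and b': "\<And>n. qpoch q b' n \<noteq> 0"
    and s: "(\<lambda>n. qratio q a b n * x ^ n) summable_on UNIV"
  shows "(\<lambda>n. qratio q a b' n * x ^ n) summable_on UNIV"
proof -
  obtain K where K: "\<And>n. norm (qpoch q b n / qpoch q b' n) \<le> K"
    using qpoch_ratio_bounded[OF q b'] by blast
  have "(\<lambda>n. qratio q a b n * x ^ n * (qpoch q b n / qpoch q b' n)) summable_on UNIV"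
    using s K by (rule summable_on_mult_bounded)
  then show ?thesis
    using b by (simp add: qratio_def)
qed

text \<open>
  With \<open>u\<close> the coefficients for the lower parameter \<open>b\<close>, those for \<open>b * q\<close> are proportional to
  \<open>a * u n - b * u (n + 1)\<close>, because \<open>a * (1 - b * q ^ n) - b * (1 - a * q ^ n)\<close> is the constant
  \<open>a - b\<close>. Summation over \<open>n\<close> is then a shift of the index.
\<close>

lemma qratio_contiguous:
  assumes b: "\<And>n. qpoch q b n \<noteq> 0"
    and s: "(\<lambda>n. qratio q a b n * x ^ n) summable_on UNIV"
  shows "(a - b) * x * psum (qratio q a (b * q)) x
           = (1 - b) * (a * x * psum (qratio q a b) x - b * (psum (qratio q a b) x - 1))"
proof -
  let ?u = "qratio q a b"
  have coeff: "(a - b) * qratio q a (b * q) n = (1 - b) * (a * ?u n - b * ?u (Suc n))" for n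
  proof -
    have "1 - b \<noteq> 0" "1 - b * q ^ n \<noteq> 0" "qpoch q b n \<noteq> 0"
      using b[of 1] b[of "Suc n"] by (auto simp: qpoch_Suc)
    moreover have "qpoch q (b * q) n = qpoch q b n * (1 - b * q ^ n) / (1 - b)"
      using qpoch_Suc_left[of q b n] \<open>1 - b \<noteq> 0\<close> by (simp add: qpoch_Suc field_simps)
    ultimately have P: "qpoch q (b * q) n = qpoch q b n * (1 - b * q ^ n) / (1 - b)"
      and nz: "qpoch q b n \<noteq> 0" "1 - b * q ^ n \<noteq> 0"
      by auto
    have clear: "a * (A / P) - b * (A * R / (P * Q)) = A * (a * Q - b * R) / (P * Q)"
      if "P \<noteq> 0" "Q \<noteq> 0" for A P Q R
      using that by (simp add: field_simps)
    have "a * ?u n - b * ?u (Suc n)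
        = qpoch q a n * (a * (1 - b * q ^ n) - b * (1 - a * q ^ n)) / (qpoch q b n * (1 - b * q ^ n))"
      unfolding qratio_def qpoch_Suc by (rule clear[OF nz])
    also have "a * (1 - b * q ^ n) - b * (1 - a * q ^ n) = a - b"
      by (simp add: algebra_simps)
    finally show ?thesis
      by (simp add: qratio_def P)
  qed
  have s1: "(\<lambda>n. ?u (Suc n) * x ^ Suc n) summable_on UNIV"
    using infsum_nat_split_first(2)[OF s] by simp
  have "psum ?u x - 1 = (\<Sum>\<^sub>\<infinity>n. ?u (Suc n) * x ^ Suc n)"
    using infsum_nat_split_first(1)[OF s] by (simp add: psum_def qratio_def)
  then have "a * x * psum ?u x - b * (psum ?u x - 1)
          = (\<Sum>\<^sub>\<infinity>n. a * x * (?u n * x ^ n)) - (\<Sum>\<^sub>\<infinity>n. b * (?u (Suc n) * x ^ Suc n))"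
    by (simp only: psum_def infsum_cmult_right')
  also have "\<dots> = (\<Sum>\<^sub>\<infinity>n. a * x * (?u n * x ^ n) - b * (?u (Suc n) * x ^ Suc n))"
    by (intro infsum_diff_complex(2)[symmetric] summable_on_cmult_right s s1)
  finally have "(1 - b) * (a * x * psum ?u x - b * (psum ?u x - 1))
      = (\<Sum>\<^sub>\<infinity>n. (1 - b) * (a * x * (?u n * x ^ n) - b * (?u (Suc n) * x ^ Suc n)))"
    by (simp only: infsum_cmult_right')
  also have "\<dots> = (\<Sum>\<^sub>\<infinity>n. (a - b) * x * (qratio q a (b * q) n * x ^ n))"
  proof (rule infsum_cong)
    fix n
    have "(1 - b) * (a * x * (?u n * x ^ n) - b * (?u (Suc n) * x ^ Suc n))
            = x ^ Suc n * ((1 - b) * (a * ?u n - b * ?u (Suc n)))"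
      by (simp add: algebra_simps)
    then show "(1 - b) * (a * x * (?u n * x ^ n) - b * (?u (Suc n) * x ^ Suc n))
            = (a - b) * x * (qratio q a (b * q) n * x ^ n)"
      unfolding coeff[symmetric] by (simp add: mult_ac)
  qed
  finally show ?thesis
    by (simp only: psum_def infsum_cmult_right')
qed

lemma qratio_functional_equation:
  assumes q: "norm q < 1" and b: "\<And>n. qpoch q b n \<noteq> 0"
    and s: "(\<lambda>n. qratio q a b n * x ^ n) summable_on UNIV"
  shows "q * (1 - x) * psum (qratio q a b) x - (b - a * x * q) * psum (qratio q a b) (x * q) = q - b"
proof -
  let ?u = "qratio q a b"
  have coeff: "?u (Suc n) * (1 - b * q ^ n) = ?u n * (1 - a * q ^ n)" for n
    using b[of n] b[of "Suc n"] by (simp add: qratio_def qpoch_Suc)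
  have s': "(\<lambda>n. ?u n * (x * q) ^ n) summable_on UNIV"
    using s q by (intro psum_shrink_summable) auto
  have s1: "(\<lambda>n. ?u (Suc n) * x ^ Suc n) summable_on UNIV"
    and s1': "(\<lambda>n. ?u (Suc n) * (x * q) ^ Suc n) summable_on UNIV"
    using infsum_nat_split_first(2)[OF s] infsum_nat_split_first(2)[OF s'] by simp_all
  have "psum ?u x - 1 = (\<Sum>\<^sub>\<infinity>n. ?u (Suc n) * x ^ Suc n)"
    and "psum ?u (x * q) - 1 = (\<Sum>\<^sub>\<infinity>n. ?u (Suc n) * (x * q) ^ Suc n)"
    using infsum_nat_split_first(1)[OF s] infsum_nat_split_first(1)[OF s']
    by (simp_all add: psum_def qratio_def)
  then have "q * (psum ?u x - 1) - b * (psum ?u (x * q) - 1)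
      = (\<Sum>\<^sub>\<infinity>n. q * (?u (Suc n) * x ^ Suc n)) - (\<Sum>\<^sub>\<infinity>n. b * (?u (Suc n) * (x * q) ^ Suc n))"
    by (simp only: infsum_cmult_right')
  also have "\<dots> = (\<Sum>\<^sub>\<infinity>n. q * (?u (Suc n) * x ^ Suc n) - b * (?u (Suc n) * (x * q) ^ Suc n))"
    by (intro infsum_diff_complex(2)[symmetric] summable_on_cmult_right s1 s1')
  also have "\<dots> = (\<Sum>\<^sub>\<infinity>n. q * x * (?u n * x ^ n) - q * x * a * (?u n * (x * q) ^ n))"
  proof (rule infsum_cong)
    fix n
    have "q * (?u (Suc n) * x ^ Suc n) - b * (?u (Suc n) * (x * q) ^ Suc n)
            = q * x ^ Suc n * (?u (Suc n) * (1 - b * q ^ n))"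
      by (simp add: algebra_simps power_mult_distrib)
    then show "q * (?u (Suc n) * x ^ Suc n) - b * (?u (Suc n) * (x * q) ^ Suc n)
            = q * x * (?u n * x ^ n) - q * x * a * (?u n * (x * q) ^ n)"
      unfolding coeff by (simp add: algebra_simps power_mult_distrib)
  qed
  also have "\<dots> = (\<Sum>\<^sub>\<infinity>n. q * x * (?u n * x ^ n)) - (\<Sum>\<^sub>\<infinity>n. q * x * a * (?u n * (x * q) ^ n))"
    by (intro infsum_diff_complex(2) summable_on_cmult_right s s')
  also have "\<dots> = q * x * psum ?u x - q * x * a * psum ?u (x * q)"
    by (simp only: psum_def infsum_cmult_right')
  finally show ?thesis
    by (simp add: algebra_simps)
qed

text \<open>
  As the lower parameter shrinks to 0, each coefficient tends to \<open>qpoch q a n\<close>. A uniform bound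
  is available because all the denominators are quotients of values of \<open>qpoch q b\<close>, so Tannery's
  theorem applies.
\<close>

lemma qratio_confluent_limit:
  assumes q: "norm q < 1" and b: "\<And>n. qpoch q b n \<noteq> 0"
    and s: "(\<lambda>n. qratio q a b n * x ^ n) summable_on UNIV"
  shows "(\<lambda>N. psum (qratio q a (b * q ^ N)) x) \<longlonglongrightarrow> psum (qpoch q a) x"
proof -
  obtain K1 where K1: "\<And>n. norm (qpoch q b n) \<le> K1"
    using qpoch_bounded[OF q] by blast
  obtain K2 where K2: "\<And>n. norm (1 / qpoch q b n) \<le> K2"
    using inverse_qpoch_bounded[OF q b] by blast
  have bN: "qpoch q (b * q ^ N) n \<noteq> 0" for N n
    using b[of "N + n"] by (auto simp: qpoch_add)
  have bound: "norm (qratio q a (b * q ^ N) n * x ^ n) \<le> K1 * (K1 * K2) * norm (qratio q a b n * x ^ n)" for N n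
  proof -
    have "qratio q a (b * q ^ N) n * x ^ n
            = qpoch q b n * (qpoch q b N * (1 / qpoch q b (N + n))) * (qratio q a b n * x ^ n)"
      using b by (simp add: qratio_def qpoch_add)
    also have "norm \<dots> = norm (qpoch q b n) * (norm (qpoch q b N) * norm (1 / qpoch q b (N + n)))
                         * norm (qratio q a b n * x ^ n)"
      by (simp only: norm_mult)
    also have "\<dots> \<le> K1 * (K1 * K2) * norm (qratio q a b n * x ^ n)"
      using order_trans[OF norm_ge_zero K1] order_trans[OF norm_ge_zero K2] K1 K2
      by (intro mult_right_mono mult_mono) auto
    finally show ?thesis .
  qed
  have abs: "(\<lambda>n. norm (qratio q a b n * x ^ n)) summable_on UNIV"
    using s by (rule summable_on_norm_complex)
  have "summable (\<lambda>n. K1 * (K1 * K2) * norm (qratio q a b n * x ^ n))"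
    using summable_on_imp_summable[OF abs] by (rule summable_mult)
  moreover have "(\<lambda>N. qratio q a (b * q ^ N) n * x ^ n) \<longlonglongrightarrow> qpoch q a n * x ^ n" for n
  proof -
    have "(\<lambda>N. q ^ N) \<longlonglongrightarrow> 0"
      using q by (rule LIMSEQ_power_zero)
    then have lin: "(\<lambda>N. b * q ^ N * q ^ i) \<longlonglongrightarrow> b * 0 * q ^ i" for i
      by (intro tendsto_mult tendsto_const)
    have "(\<lambda>N. qpoch q (b * q ^ N) n) \<longlonglongrightarrow> (\<Prod>i<n. 1 - b * 0 * q ^ i)"
      unfolding qpoch_def by (intro tendsto_prod tendsto_diff tendsto_const lin)
    then have "(\<lambda>N. qpoch q a n / qpoch q (b * q ^ N) n * x ^ n) \<longlonglongrightarrow> qpoch q a n / 1 * x ^ n"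
      by (intro tendsto_intros) auto
    then show ?thesis by (simp add: qratio_def)
  qed
  ultimately have lim: "(\<lambda>N. \<Sum>n. qratio q a (b * q ^ N) n * x ^ n) \<longlonglongrightarrow> (\<Sum>n. qpoch q a n * x ^ n)"
    using tannerys_theorem[of "\<lambda>n N. qratio q a (b * q ^ N) n * x ^ n" "\<lambda>n. qpoch q a n * x ^ n"
        sequentially "\<lambda>n. K1 * (K1 * K2) * norm (qratio q a b n * x ^ n)"] bound
    by (auto intro: always_eventually)
  have psum_suminf: "psum V x = (\<Sum>n. V n * x ^ n)" if "(\<lambda>n. V n * x ^ n) summable_on UNIV" for V
    unfolding psum_def using has_sum_imp_sums[OF has_sum_infsum[OF that]] by (rule sums_unique)
  have sN: "(\<lambda>n. qratio q a (b * q ^ N) n * x ^ n) summable_on UNIV" for N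
    using q b bN s by (rule qratio_summable_shift)
  have "(\<lambda>n. qratio q a b n * x ^ n * qpoch q b n) summable_on UNIV"
    using s K1 by (rule summable_on_mult_bounded)
  then have "(\<lambda>n. qpoch q a n * x ^ n) summable_on UNIV"
    using b by (simp add: qratio_def mult_ac)
  with lim sN show ?thesis
    by (simp add: psum_suminf)
qed

text \<open>
  The analogue of \<open>three_term_shift\<close> for a vanishing lower parameter and the shift \<open>\<alpha> \<mapsto> \<alpha> / q\<close>. It
  serves to reach those parameters at which the direct evaluation of the degenerate sum fails.
\<close>

lemma degenerate_three_term_shift:
  assumes q: "norm q < 1" "q \<noteq> 0" and nz: "\<alpha> \<noteq> 0" "t \<noteq> 0"
    and s1: "(\<lambda>n. qpoch q \<alpha> n * t ^ n) summable_on UNIV"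
    and s2: "(\<lambda>n. qpoch q (q / t) n * (q / \<alpha>) ^ n) summable_on UNIV"
  shows "(\<lambda>n. qpoch q (\<alpha> / q) n * t ^ n) summable_on UNIV"
    and "(\<lambda>n. qpoch q (q / t) n * (q / (\<alpha> / q)) ^ n) summable_on UNIV"
    and "(1 - q / \<alpha>) * (psum (qpoch q \<alpha>) t - q / (\<alpha> * t) * psum (qpoch q (q / t)) (q / \<alpha>))
       = - (q / (\<alpha> * t)) * (psum (qpoch q (\<alpha> / q)) t
            - q / (\<alpha> / q * t) * psum (qpoch q (q / t)) (q / (\<alpha> / q)))"
proof -
  let ?F = "psum (qpoch q \<alpha>) t" and ?S = "psum (qpoch q (q / t)) (q / \<alpha>)"
  let ?F' = "psum (qpoch q (\<alpha> / q)) t" and ?S' = "psum (qpoch q (q / t)) (q / (\<alpha> / q))"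
  have bij: "bij_betw Suc UNIV {1..}"
    by (rule bij_betwI[of _ _ _ "\<lambda>n. n - 1"]) auto
  have term_Suc: "qpoch q (\<alpha> / q) (Suc n) * t ^ Suc n = (1 - \<alpha> / q) * t * (qpoch q \<alpha> n * t ^ n)" for n
    using q(2) by (simp add: qpoch_Suc_left)
  have "(\<lambda>n. qpoch q (\<alpha> / q) (Suc n) * t ^ Suc n) summable_on UNIV"
    unfolding term_Suc using s1 by (rule summable_on_cmult_right)
  then have "(\<lambda>n. qpoch q (\<alpha> / q) n * t ^ n) summable_on {1..}"
    using summable_on_reindex_bij_betw[OF bij, of "\<lambda>n. qpoch q (\<alpha> / q) n * t ^ n"] by simp
  then show s1': "(\<lambda>n. qpoch q (\<alpha> / q) n * t ^ n) summable_on UNIV"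
    by (rule summable_on_nat_from_1)
  have F': "?F' = 1 + (1 - \<alpha> / q) * t * ?F"
    using infsum_nat_split_first(1)[OF s1'] unfolding psum_def term_Suc infsum_cmult_right' by simp

  let ?x = "q / \<alpha>" and ?a = "q / t"
  have "(\<lambda>n. qpoch q ?a n * (?x * q) ^ n) summable_on UNIV"
    using s2 q by (intro psum_shrink_summable) auto
  then show s2': "(\<lambda>n. qpoch q (q / t) n * (q / (\<alpha> / q)) ^ n) summable_on UNIV"
    by simp
  have s2_Suc: "(\<lambda>n. qpoch q ?a (Suc n) * ?x ^ Suc n) summable_on UNIV"
    using infsum_nat_split_first(2)[OF s2] by simp
  have shift_S: "?x * ?a * (qpoch q ?a n * (q / (\<alpha> / q)) ^ n)
        = ?x * (qpoch q ?a n * ?x ^ n) - qpoch q ?a (Suc n) * ?x ^ Suc n" for n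
    by (simp add: qpoch_Suc power_mult_distrib power_divide algebra_simps)
  have "?x * ?a * ?S' = (\<Sum>\<^sub>\<infinity>n. ?x * (qpoch q ?a n * ?x ^ n) - qpoch q ?a (Suc n) * ?x ^ Suc n)"
    unfolding psum_def infsum_cmult_right'[symmetric] shift_S ..
  also have "\<dots> = ?x * ?S - (\<Sum>\<^sub>\<infinity>n. qpoch q ?a (Suc n) * ?x ^ Suc n)"
    unfolding psum_def infsum_cmult_right'[symmetric]
    by (intro infsum_diff_complex(2) summable_on_cmult_right s2 s2_Suc)
  also have "(\<Sum>\<^sub>\<infinity>n. qpoch q ?a (Suc n) * ?x ^ Suc n) = ?S - 1"
    using infsum_nat_split_first(1)[OF s2] by (simp add: psum_def)
  finally have S': "?x * ?a * ?S' = ?x * ?S - (?S - 1)" .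
  have S'': "q / (\<alpha> / q * t) * ?S' = ?x * ?S - (?S - 1)"
    using S' by simp
  have "- (q / (\<alpha> * t)) * (?F' - q / (\<alpha> / q * t) * ?S')
      = - (q / (\<alpha> * t)) * ((1 - \<alpha> / q) * t * ?F + (?S - ?x * ?S))"
    unfolding F' S'' by (simp only: algebra_simps)
  also have "\<dots> = - (q / \<alpha> * (1 - \<alpha> / q)) * ?F - (1 - ?x) * (q / (\<alpha> * t) * ?S)"
    using nz by (simp add: field_simps)
  also have "- (q / \<alpha> * (1 - \<alpha> / q)) = 1 - q / \<alpha>"
    using nz q(2) by (simp add: field_simps)
  finally show "(1 - q / \<alpha>) * (?F - q / (\<alpha> * t) * ?S) = - (q / (\<alpha> * t)) * (?F' - q / (\<alpha> / q * t) * ?S')"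
    by (simp add: algebra_simps)
qed

text \<open>
  The two series have different inhomogeneous contiguous relations in \<open>\<beta>\<close>. The factor
  \<open>(\<beta> - q) / (\<beta> - \<alpha> * t)\<close> makes the inhomogeneous parts coincide (multiplied by
  \<open>\<alpha> * t\<close>, the relations have \<open>- \<beta> * (1 - \<beta>)\<close> in common), so that the difference satisfies a first-order homogeneous relation.
\<close>

lemma three_term_shift:
  assumes q: "norm q < 1" "q \<noteq> 0" and nz: "\<alpha> \<noteq> 0" "t \<noteq> 0"
    and \<beta>: "qpoch_inf q \<beta> \<noteq> 0" and \<beta>y: "qpoch_inf q (\<beta> / (\<alpha> * t)) \<noteq> 0"
    and s1: "(\<lambda>n. qratio q \<alpha> \<beta> n * t ^ n) summable_on UNIV"
    and s2: "(\<lambda>n. qratio q (q / t) (\<beta> * q / (\<alpha> * t)) n * (q / \<alpha>) ^ n) summable_on UNIV"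
  defines "D \<equiv> \<lambda>\<beta>. psum (qratio q \<alpha> \<beta>) t
      - (\<beta> - q) / (\<beta> - \<alpha> * t) * psum (qratio q (q / t) (\<beta> * q / (\<alpha> * t))) (q / \<alpha>)"
  shows "D \<beta> * (1 - \<beta>) * (1 - \<beta> / (\<alpha> * t)) = (1 - \<beta> / \<alpha>) * D (\<beta> * q)"
proof -
  define y where "y = \<alpha> * t"
  have y: "y \<noteq> 0" using nz by (simp add: y_def)
  define F where "F = psum (qratio q \<alpha> \<beta>) t"
  define F' where "F' = psum (qratio q \<alpha> (\<beta> * q)) t"
  define S where "S = psum (qratio q (q / t) (\<beta> * q / y)) (q / \<alpha>)"
  define S' where "S' = psum (qratio q (q / t) (\<beta> * q / y * q)) (q / \<alpha>)"
  have b: "qpoch q \<beta> n \<noteq> 0" for n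
    using qpoch_nonzero_if_inf(1)[OF q(1) \<beta>] .
  have "qpoch q (\<beta> / y * q) n \<noteq> 0" for n
    using qpoch_nonzero_if_inf(1)[OF q(1) \<beta>y, of "Suc n"] by (simp add: qpoch_Suc_left y_def)
  then have by': "qpoch q (\<beta> * q / y) n \<noteq> 0" for n
    by simp
  have n1: "\<beta> \<noteq> y"
    using qpoch_nonzero_if_inf(1)[OF q(1) \<beta>y, of 1] y by (auto simp: qpoch_Suc y_def)
  have n2: "\<beta> * q \<noteq> y"
    using by'[of 1] y by (auto simp: qpoch_Suc)
  have cF: "(\<alpha> - \<beta>) * t * F' = (1 - \<beta>) * (y * F - \<beta> * (F - 1))"
    using qratio_contiguous[OF b s1] by (simp add: F_def F'_def y_def)
  have cS: "(q / t - \<beta> * q / y) * (q / \<alpha>) * S'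
      = (1 - \<beta> * q / y) * (q / t * (q / \<alpha>) * S - \<beta> * q / y * (S - 1))"
    unfolding S_def S'_def by (rule qratio_contiguous) (use by' s2 in \<open>auto simp: y_def\<close>)
  have cS': "(\<alpha> - \<beta>) * q * t * S' = (y - \<beta> * q) * (q * S - \<beta> * (S - 1))"
  proof -
    have e1: "(q / t - \<beta> * q / y) * (q / \<alpha>) * S' = (q / (y * y)) * ((\<alpha> - \<beta>) * q * t * S')"
      using nz by (simp add: y_def field_simps)
    have e2: "(1 - \<beta> * q / y) * (q / t * (q / \<alpha>) * S - \<beta> * q / y * (S - 1))
      = (q / (y * y)) * ((y - \<beta> * q) * (q * S - \<beta> * (S - 1)))"
      using nz by (simp add: y_def field_simps)
    have "(q / (y * y)) * ((\<alpha> - \<beta>) * q * t * S') = (q / (y * y)) * ((y - \<beta> * q) * (q * S - \<beta> * (S - 1)))"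
      using cS unfolding e1 e2 .
    then show ?thesis using q(2) y by simp
  qed
  have D1: "D \<beta> = F - (\<beta> - q) / (\<beta> - y) * S"
    by (simp add: D_def F_def S_def y_def)
  have D2: "D (\<beta> * q) = F' - (\<beta> * q - q) / (\<beta> * q - y) * S'"
    by (simp add: D_def F'_def S'_def y_def mult_ac)
  have "D \<beta> * (1 - \<beta>) * (1 - \<beta> / y) * y = (1 - \<beta>) * ((y - \<beta>) * D \<beta>)"
    using y by (simp add: field_simps)
  also have "(y - \<beta>) * D \<beta> = (y - \<beta>) * F + (\<beta> - q) * S"
    unfolding D1 using n1 by (simp add: field_simps)
  also have "(1 - \<beta>) * \<dots> = (1 - \<beta>) * (y * F - \<beta> * (F - 1)) - (1 - \<beta>) * (q * S - \<beta> * (S - 1))"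
    by (simp add: algebra_simps)
  also have "\<dots> = (\<alpha> - \<beta>) * t * F' - (1 - \<beta>) * ((\<alpha> - \<beta>) * q * t * S' / (y - \<beta> * q))"
    unfolding cF cS' using n2 by simp
  also have "\<dots> = (\<alpha> - \<beta>) * t * D (\<beta> * q)"
    unfolding D2 using n2 by (simp add: divide_simps) (simp add: algebra_simps)
  also have "\<dots> = (1 - \<beta> / \<alpha>) * D (\<beta> * q) * y"
    using nz by (simp add: y_def field_simps)
  finally show ?thesis
    using y by (simp add: y_def)
qed


text \<open>
  Iterating the shift \<open>\<beta> \<mapsto> \<beta> * q\<close> sends the lower parameter to 0.
\<close>

lemma three_term_to_degenerate:
  assumes q: "norm q < 1" "q \<noteq> 0" and nz: "\<alpha> \<noteq> 0" "t \<noteq> 0"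
    and \<beta>: "qpoch_inf q \<beta> \<noteq> 0" and \<beta>y: "qpoch_inf q (\<beta> / (\<alpha> * t)) \<noteq> 0"
    and s1: "(\<lambda>n. qratio q \<alpha> \<beta> n * t ^ n) summable_on UNIV"
    and s2: "(\<lambda>n. qratio q (q / t) (\<beta> * q / (\<alpha> * t)) n * (q / \<alpha>) ^ n) summable_on UNIV"
  shows "(psum (qratio q \<alpha> \<beta>) t
           - (\<beta> - q) / (\<beta> - \<alpha> * t) * psum (qratio q (q / t) (\<beta> * q / (\<alpha> * t))) (q / \<alpha>))
         * qpoch_inf q \<beta> * qpoch_inf q (\<beta> / (\<alpha> * t))
       = qpoch_inf q (\<beta> / \<alpha>)
         * (psum (qpoch q \<alpha>) t - q / (\<alpha> * t) * psum (qpoch q (q / t)) (q / \<alpha>))"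
proof -
  define D where "D = (\<lambda>\<beta>. psum (qratio q \<alpha> \<beta>) t
      - (\<beta> - q) / (\<beta> - \<alpha> * t) * psum (qratio q (q / t) (\<beta> * q / (\<alpha> * t))) (q / \<alpha>))"
  have b: "qpoch q \<beta> n \<noteq> 0" for n
    using qpoch_nonzero_if_inf(1)[OF q(1) \<beta>] .
  have bN: "qpoch_inf q (\<beta> * q ^ N) \<noteq> 0" for N
    using qpoch_nonzero_if_inf(2)[OF q(1) \<beta>] .
  have byN: "qpoch_inf q (\<beta> * q ^ N / (\<alpha> * t)) \<noteq> 0" for N
    using qpoch_nonzero_if_inf(2)[OF q(1) \<beta>y, of N] by simp
  have byN': "qpoch_inf q (\<beta> * q ^ N * q / (\<alpha> * t)) \<noteq> 0" for N
    using byN[of "Suc N"] by (simp add: mult_ac)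
  have by': "qpoch q (\<beta> * q / (\<alpha> * t)) n \<noteq> 0" for n
    using qpoch_nonzero_if_inf(1)[OF q(1) byN'[of 0]] by simp
  have s1N: "(\<lambda>n. qratio q \<alpha> (\<beta> * q ^ N) n * t ^ n) summable_on UNIV" for N
    using q(1) b qpoch_nonzero_if_inf(1)[OF q(1) bN] s1 by (rule qratio_summable_shift)
  have s2N: "(\<lambda>n. qratio q (q / t) (\<beta> * q ^ N * q / (\<alpha> * t)) n * (q / \<alpha>) ^ n) summable_on UNIV" for N
    using q(1) by' qpoch_nonzero_if_inf(1)[OF q(1) byN'] s2 by (rule qratio_summable_shift)
  have iter: "D \<beta> * qpoch q \<beta> N * qpoch q (\<beta> / (\<alpha> * t)) N = qpoch q (\<beta> / \<alpha>) N * D (\<beta> * q ^ N)" for N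
  proof (induction N)
    case (Suc N)
    have st: "D (\<beta> * q ^ N) * (1 - \<beta> * q ^ N) * (1 - \<beta> * q ^ N / (\<alpha> * t))
        = (1 - \<beta> * q ^ N / \<alpha>) * D (\<beta> * q ^ Suc N)"
      using three_term_shift[OF q nz bN byN s1N s2N, of N] by (simp add: D_def mult_ac)
    have "D \<beta> * qpoch q \<beta> (Suc N) * qpoch q (\<beta> / (\<alpha> * t)) (Suc N)
        = (D \<beta> * qpoch q \<beta> N * qpoch q (\<beta> / (\<alpha> * t)) N) * ((1 - \<beta> * q ^ N) * (1 - \<beta> * q ^ N / (\<alpha> * t)))"
      by (simp add: qpoch_Suc mult_ac)
    also have "\<dots> = qpoch q (\<beta> / \<alpha>) N
        * (D (\<beta> * q ^ N) * (1 - \<beta> * q ^ N) * (1 - \<beta> * q ^ N / (\<alpha> * t)))"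
      unfolding Suc.IH by (simp only: mult_ac)
    also have "\<dots> = qpoch q (\<beta> / \<alpha>) (Suc N) * D (\<beta> * q ^ Suc N)"
      unfolding st by (simp add: qpoch_Suc mult_ac)
    finally show ?case .
  qed simp
  have "(\<lambda>N. D (\<beta> * q ^ N)) \<longlonglongrightarrow> psum (qpoch q \<alpha>) t
      - (\<beta> * 0 - q) / (\<beta> * 0 - \<alpha> * t) * psum (qpoch q (q / t)) (q / \<alpha>)"
  proof -
    have qN: "(\<lambda>N. q ^ N) \<longlonglongrightarrow> 0"
      using q(1) by (rule LIMSEQ_power_zero)
    have "\<beta> * q ^ N * q / (\<alpha> * t) = \<beta> * q / (\<alpha> * t) * q ^ N" for N
      by simp
    then have "(\<lambda>N. psum (qratio q (q / t) (\<beta> * q ^ N * q / (\<alpha> * t))) (q / \<alpha>))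
        \<longlonglongrightarrow> psum (qpoch q (q / t)) (q / \<alpha>)"
      using qratio_confluent_limit[OF q(1) by' s2] by (simp only:)
    then show ?thesis
      unfolding D_def using nz
      by (intro tendsto_diff tendsto_mult tendsto_divide tendsto_const qN
          qratio_confluent_limit[OF q(1) b s1]) auto
  qed
  then have lim: "(\<lambda>N. qpoch q (\<beta> / \<alpha>) N * D (\<beta> * q ^ N)) \<longlonglongrightarrow> qpoch_inf q (\<beta> / \<alpha>)
      * (psum (qpoch q \<alpha>) t - q / (\<alpha> * t) * psum (qpoch q (q / t)) (q / \<alpha>))"
    using tendsto_mult[OF qpoch_tendsto(1)[OF q(1)]] by fastforce
  have lim': "(\<lambda>N. D \<beta> * qpoch q \<beta> N * qpoch q (\<beta> / (\<alpha> * t)) N)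
      \<longlonglongrightarrow> D \<beta> * qpoch_inf q \<beta> * qpoch_inf q (\<beta> / (\<alpha> * t))"
    by (intro tendsto_mult tendsto_const qpoch_tendsto(1) q)
  have "D \<beta> * qpoch_inf q \<beta> * qpoch_inf q (\<beta> / (\<alpha> * t)) = qpoch_inf q (\<beta> / \<alpha>)
      * (psum (qpoch q \<alpha>) t - q / (\<alpha> * t) * psum (qpoch q (q / t)) (q / \<alpha>))"
    using lim'[unfolded iter] lim by (rule LIMSEQ_unique)
  then show ?thesis
    unfolding D_def .
qed

text \<open>
  The reduction to a vanishing lower parameter holds for every admissible \<open>\<beta>\<close>, and at \<open>\<beta> = q\<close> the
  second series has the coefficient 0 while the first is summed by the q-binomial theorem. Reading
  the reduction backwards there evaluates the degenerate sum. The choice \<open>\<beta> = q\<close> is admissible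
  unless \<open>\<alpha> * t\<close> is a positive power of \<open>q\<close>; in that case repeated shifts \<open>\<alpha> \<mapsto> \<alpha> / q\<close> lead to
  \<open>\<alpha> * t = 1\<close>, where the sum vanishes.
\<close>

lemma degenerate_three_term_sum:
  assumes q: "norm q < 1" "q \<noteq> 0" and nz: "\<alpha> \<noteq> 0" "t \<noteq> 0"
    and s1: "(\<lambda>n. qpoch q \<alpha> n * t ^ n) summable_on UNIV"
    and s2: "(\<lambda>n. qpoch q (q / t) n * (q / \<alpha>) ^ n) summable_on UNIV"
  shows "(psum (qpoch q \<alpha>) t - q / (\<alpha> * t) * psum (qpoch q (q / t)) (q / \<alpha>))
           * qpoch_inf q (q / \<alpha>) * qpoch_inf q t
         = qpoch_inf q q * qpoch_inf q (\<alpha> * t) * qpoch_inf q (q / (\<alpha> * t))"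
proof -
  have qq: "qpoch_inf q q \<noteq> 0"
    using qpoch_tendsto(2)[OF q(1)] qpoch_q_nonzero[OF q(1)] by blast
  have generic: "(psum (qpoch q \<alpha>) t - q / (\<alpha> * t) * psum (qpoch q (q / t)) (q / \<alpha>))
           * qpoch_inf q (q / \<alpha>) * qpoch_inf q t
         = qpoch_inf q q * qpoch_inf q (\<alpha> * t) * qpoch_inf q (q / (\<alpha> * t))"
    if nz: "\<alpha> \<noteq> 0"
      and s1: "(\<lambda>n. qpoch q \<alpha> n * t ^ n) summable_on UNIV"
      and s2: "(\<lambda>n. qpoch q (q / t) n * (q / \<alpha>) ^ n) summable_on UNIV"
      and gen: "qpoch_inf q (q / (\<alpha> * t)) \<noteq> 0" for \<alpha>
  proof -
    obtain K where K: "\<And>n. norm (1 / qpoch q q n) \<le> K"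
      using inverse_qpoch_bounded[OF q(1) qpoch_q_nonzero[OF q(1)]] by blast
    have "(\<lambda>n. qpoch q \<alpha> n * t ^ n * (1 / qpoch q q n)) summable_on UNIV"
      using s1 K by (rule summable_on_mult_bounded)
    then have t1: "(\<lambda>n. qratio q \<alpha> q n * t ^ n) summable_on UNIV"
      by (simp add: qratio_def)
    have "qpoch_inf q (q * q / (\<alpha> * t)) \<noteq> 0"
      using qpoch_nonzero_if_inf(2)[OF q(1) gen, of 1] by simp
    note y2 = qpoch_nonzero_if_inf(1)[OF q(1) this]
    obtain K' where K': "\<And>n. norm (1 / qpoch q (q * q / (\<alpha> * t)) n) \<le> K'"
      using inverse_qpoch_bounded[OF q(1) y2] by blast
    have "(\<lambda>n. qpoch q (q / t) n * (q / \<alpha>) ^ n * (1 / qpoch q (q * q / (\<alpha> * t)) n)) summable_on UNIV"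
      using s2 K' by (rule summable_on_mult_bounded)
    then have t2: "(\<lambda>n. qratio q (q / t) (q * q / (\<alpha> * t)) n * (q / \<alpha>) ^ n) summable_on UNIV"
      by (simp add: qratio_def)
    have "qcoeff q \<alpha> = qratio q \<alpha> q"
      by (simp add: fun_eq_iff qcoeff_def qratio_def)
    then have binom: "qpoch_inf q t * psum (qratio q \<alpha> q) t = qpoch_inf q (\<alpha> * t)"
      using q_binomial[OF q(1), of \<alpha> t] t1 by simp
    have "psum (qratio q \<alpha> q) t * qpoch_inf q q * qpoch_inf q (q / (\<alpha> * t)) = qpoch_inf q (q / \<alpha>)
        * (psum (qpoch q \<alpha>) t - q / (\<alpha> * t) * psum (qpoch q (q / t)) (q / \<alpha>))"
      using three_term_to_degenerate[OF q nz \<open>t \<noteq> 0\<close> qq gen t1 t2] by simp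
    moreover have "Y * x * T = Q * B * c" if "T * A = B" "A * Q * c = x * Y" for A B Q T Y c x :: complex
    proof -
      have "Y * x * T = T * (x * Y)"
        by (simp only: mult_ac)
      also have "\<dots> = Q * (T * A) * c"
        unfolding that(2)[symmetric] by (simp only: mult_ac)
      finally show ?thesis
        unfolding that(1) .
    qed
    ultimately show ?thesis
      using binom by blast
  qed
  (* The induction ends at alpha * t = 1, where generic applies and gives 0 because (1)_inf = 0. *)
  have singular: "(psum (qpoch q \<alpha>) t - q / (\<alpha> * t) * psum (qpoch q (q / t)) (q / \<alpha>))
           * qpoch_inf q (q / \<alpha>) * qpoch_inf q t = 0"
    if "\<alpha> * t = q ^ n" "\<alpha> \<noteq> 0"
      and "(\<lambda>n. qpoch q \<alpha> n * t ^ n) summable_on UNIV"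
      and "(\<lambda>n. qpoch q (q / t) n * (q / \<alpha>) ^ n) summable_on UNIV" for n \<alpha>
    using that
  proof (induction n arbitrary: \<alpha>)
    case 0
    then have "\<alpha> * t = 1" by simp
    moreover have "qpoch_inf q 1 = 0"
      using qpoch_inf_split_first[OF q(1), of 1] by simp
    ultimately show ?case
      using generic[OF 0(2,3,4)] qq by simp
  next
    case (Suc n)
    note shift = degenerate_three_term_shift[OF q Suc.prems(2) \<open>t \<noteq> 0\<close> Suc.prems(3,4)]
    have "\<alpha> / q * t = q ^ n"
      using Suc.prems(1) q(2) by (simp add: field_simps)
    from Suc.IH[OF this _ shift(1,2)] Suc.prems(2) q(2)
    have IH: "(psum (qpoch q (\<alpha> / q)) t - q / (\<alpha> / q * t) * psum (qpoch q (q / t)) (q / (\<alpha> / q)))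
        * qpoch_inf q (q / (\<alpha> / q)) * qpoch_inf q t = 0"
      by simp
    have "qpoch_inf q (q / \<alpha>) = (1 - q / \<alpha>) * qpoch_inf q (q / (\<alpha> / q))"
      using qpoch_inf_split_first[OF q(1), of "q / \<alpha>"] by simp
    then have "(psum (qpoch q \<alpha>) t - q / (\<alpha> * t) * psum (qpoch q (q / t)) (q / \<alpha>))
           * qpoch_inf q (q / \<alpha>) * qpoch_inf q t
        = ((1 - q / \<alpha>) * (psum (qpoch q \<alpha>) t - q / (\<alpha> * t) * psum (qpoch q (q / t)) (q / \<alpha>)))
           * qpoch_inf q (q / (\<alpha> / q)) * qpoch_inf q t"
      by (simp only: mult_ac)
    also have "\<dots> = - (q / (\<alpha> * t))
        * ((psum (qpoch q (\<alpha> / q)) t - q / (\<alpha> / q * t) * psum (qpoch q (q / t)) (q / (\<alpha> / q)))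
           * qpoch_inf q (q / (\<alpha> / q)) * qpoch_inf q t)"
      unfolding shift(3) by (simp only: mult_ac)
    finally show ?case
      unfolding IH by simp
  qed
  show ?thesis
  proof (cases "qpoch_inf q (q / (\<alpha> * t)) = 0")
    case True
    then obtain n where "qpoch q (q / (\<alpha> * t)) n = 0"
      using qpoch_tendsto(2)[OF q(1)] by blast
    then obtain i where "1 - q / (\<alpha> * t) * q ^ i = 0"
      by (auto simp: qpoch_def)
    then have "\<alpha> * t = q ^ Suc i"
      using nz by (simp add: field_simps)
    from singular[OF this nz(1) s1 s2] True show ?thesis
      by simp
  next
    case False
    then show ?thesis
      using generic nz s1 s2 by blast
  qed
qed

text \<open>
  This is Ramanujan's sum of the bilateral series with parameters \<open>\<alpha>\<close>, \<open>\<beta>\<close>, whose half over the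
  negative indices is replaced by its continuation: the series in powers of \<open>q / \<alpha>\<close> converges
  for other arguments than the original one in powers of \<open>\<beta> / (\<alpha> * t)\<close>.
\<close>

lemma three_term_sum:
  assumes q: "norm q < 1" "q \<noteq> 0" and nz: "\<alpha> \<noteq> 0" "t \<noteq> 0"
    and \<beta>: "qpoch_inf q \<beta> \<noteq> 0" and \<beta>y: "qpoch_inf q (\<beta> / (\<alpha> * t)) \<noteq> 0"
    and den: "qpoch_inf q (q / \<alpha>) \<noteq> 0" "qpoch_inf q t \<noteq> 0"
    and s1: "(\<lambda>n. qratio q \<alpha> \<beta> n * t ^ n) summable_on UNIV"
    and s2: "(\<lambda>n. qratio q (q / t) (\<beta> * q / (\<alpha> * t)) n * (q / \<alpha>) ^ n) summable_on UNIV"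
  shows "psum (qratio q \<alpha> \<beta>) t
       = qpoch_inf q (\<beta> / \<alpha>) * qpoch_inf q q * qpoch_inf q (\<alpha> * t) * qpoch_inf q (q / (\<alpha> * t))
           / (qpoch_inf q (q / \<alpha>) * qpoch_inf q \<beta> * qpoch_inf q (\<beta> / (\<alpha> * t)) * qpoch_inf q t)
         + (\<beta> - q) / (\<beta> - \<alpha> * t) * psum (qratio q (q / t) (\<beta> * q / (\<alpha> * t))) (q / \<alpha>)"
proof -
  define D where "D = psum (qratio q \<alpha> \<beta>) t
      - (\<beta> - q) / (\<beta> - \<alpha> * t) * psum (qratio q (q / t) (\<beta> * q / (\<alpha> * t))) (q / \<alpha>)"
  define D0 where "D0 = psum (qpoch q \<alpha>) t - q / (\<alpha> * t) * psum (qpoch q (q / t)) (q / \<alpha>)"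
  have b: "qpoch q \<beta> n \<noteq> 0" for n
    using qpoch_nonzero_if_inf(1)[OF q(1) \<beta>] .
  have "qpoch_inf q (\<beta> * q / (\<alpha> * t)) \<noteq> 0"
    using qpoch_nonzero_if_inf(2)[OF q(1) \<beta>y, of 1] by simp
  note by' = qpoch_nonzero_if_inf(1)[OF q(1) this]
  have clear: "(\<lambda>n. qpoch q a n * x ^ n) summable_on UNIV"
    if b: "\<And>n. qpoch q b n \<noteq> 0" and s: "(\<lambda>n. qratio q a b n * x ^ n) summable_on UNIV" for a b x
  proof -
    obtain K where K: "\<And>n. norm (qpoch q b n) \<le> K"
      using qpoch_bounded[OF q(1)] by blast
    have "(\<lambda>n. qratio q a b n * x ^ n * qpoch q b n) summable_on UNIV"
      using s K by (rule summable_on_mult_bounded)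
    then show ?thesis
      using b by (simp add: qratio_def)
  qed
  have "D0 * qpoch_inf q (q / \<alpha>) * qpoch_inf q t
         = qpoch_inf q q * qpoch_inf q (\<alpha> * t) * qpoch_inf q (q / (\<alpha> * t))"
    unfolding D0_def by (rule degenerate_three_term_sum[OF q nz clear[OF b s1] clear[OF by' s2]])
  then have D0: "D0 = qpoch_inf q q * qpoch_inf q (\<alpha> * t) * qpoch_inf q (q / (\<alpha> * t))
      / (qpoch_inf q (q / \<alpha>) * qpoch_inf q t)"
    using den by (simp add: nonzero_eq_divide_eq mult_ac)
  have "D * qpoch_inf q \<beta> * qpoch_inf q (\<beta> / (\<alpha> * t)) = qpoch_inf q (\<beta> / \<alpha>) * D0"
    unfolding D_def D0_def by (rule three_term_to_degenerate[OF q nz \<beta> \<beta>y s1 s2])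
  then have "D = qpoch_inf q (\<beta> / \<alpha>) * D0 / (qpoch_inf q \<beta> * qpoch_inf q (\<beta> / (\<alpha> * t)))"
    using \<beta> \<beta>y by (simp add: nonzero_eq_divide_eq mult_ac)
  also have "\<dots> = qpoch_inf q (\<beta> / \<alpha>) * qpoch_inf q q * qpoch_inf q (\<alpha> * t) * qpoch_inf q (q / (\<alpha> * t))
           / (qpoch_inf q (q / \<alpha>) * qpoch_inf q \<beta> * qpoch_inf q (\<beta> / (\<alpha> * t)) * qpoch_inf q t)"
    unfolding D0 by (simp only: times_divide_eq_right times_divide_eq_left divide_divide_eq_left mult_ac)
  finally show ?thesis
    unfolding D_def diff_eq_eq .
qed

section \<open>Summing against a linear recursion\<close>

text \<open>
  The weights \<open>W\<close> may terminate or not, and this decides whether \<open>x\<close> has to lie in the unit disc.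
  Extracting the summability of the bare weights from that of the given series avoids the
  distinction: the factors \<open>c\<close> are bounded away from 0, and so is \<open>H (i + m)\<close> except for the
  finitely many pairs with small \<open>i + m\<close>.
\<close>

lemma pair_weights_summable:
  fixes W c H :: "nat \<Rightarrow> complex"
  assumes s: "(\<lambda>(i, m). W (i + m) * x ^ i * y ^ m * (c i * H (i + m))) summable_on {1..} \<times> UNIV"
    and c: "c \<longlonglongrightarrow> c0" "c0 \<noteq> 0" "\<And>i. c i \<noteq> 0"
    and H: "H \<longlonglongrightarrow> h" "h \<noteq> 0"
  shows "(\<lambda>(i, m). W (i + m) * x ^ i * y ^ m) summable_on {1..} \<times> UNIV"
proof -
  let ?S = "{1..} \<times> (UNIV :: nat set)"
  have "(\<lambda>i. 1 / c i) \<longlonglongrightarrow> 1 / c0"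
    using c by (intro tendsto_intros)
  then have "Bseq (\<lambda>i. 1 / c i)"
    by (intro convergent_imp_Bseq convergentI)
  then obtain K where K: "\<And>i. norm (1 / c i) \<le> K"
    by (auto simp: Bseq_def)
  have "(\<lambda>n. norm (H n)) \<longlonglongrightarrow> norm h"
    using H(1) by (rule tendsto_norm)
  then have "eventually (\<lambda>n. norm (H n) > norm h / 2) sequentially"
    using H(2) by (intro order_tendstoD(1)) auto
  then obtain N where N: "\<And>n. n \<ge> N \<Longrightarrow> norm (H n) > norm h / 2"
    by (auto simp: eventually_sequentially)
  define T where "T = {(i, m). (i, m) \<in> ?S \<and> i + m \<ge> N}"
  have "(\<lambda>(i, m). W (i + m) * x ^ i * y ^ m * (c i * H (i + m)) * (1 / (c i * H (i + m)))) summable_on T"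
    unfolding case_prod_unfold
  proof (rule summable_on_mult_bounded)
    have "(\<lambda>(i, m). W (i + m) * x ^ i * y ^ m * (c i * H (i + m))) summable_on T"
      using s by (rule summable_on_subset_banach) (auto simp: T_def)
    then show "(\<lambda>p. W (fst p + snd p) * x ^ fst p * y ^ snd p * (c (fst p) * H (fst p + snd p))) summable_on T"
      by (simp add: case_prod_unfold)
    fix p assume "p \<in> T"
    then have "norm (H (fst p + snd p)) > norm h / 2"
      by (intro N) (auto simp: T_def)
    then have "norm (1 / H (fst p + snd p)) \<le> 2 / norm h"
      using H(2) by (auto simp: norm_divide divide_simps)
    then have "norm (1 / c (fst p)) * norm (1 / H (fst p + snd p)) \<le> K * (2 / norm h)"
      using K[of "fst p"] by (intro mult_mono) (auto intro: order_trans[OF norm_ge_zero])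
    then show "norm (1 / (c (fst p) * H (fst p + snd p))) \<le> K * (2 / norm h)"
      by (simp add: norm_divide norm_mult)
  qed
  moreover have "W (i + m) * x ^ i * y ^ m * (c i * H (i + m)) * (1 / (c i * H (i + m)))
      = W (i + m) * x ^ i * y ^ m" if "(i, m) \<in> T" for i m
  proof -
    have "H (i + m) \<noteq> 0"
      using that N[of "i + m"] by (auto simp: T_def)
    then show ?thesis
      using c(3)[of i] by simp
  qed
  ultimately have T: "(\<lambda>(i, m). W (i + m) * x ^ i * y ^ m) summable_on T"
    using summable_on_cong[of T "\<lambda>(i, m). W (i + m) * x ^ i * y ^ m * (c i * H (i + m)) * (1 / (c i * H (i + m)))"
        "\<lambda>(i, m). W (i + m) * x ^ i * y ^ m"] by fastforce
  have "?S - T \<subseteq> {..N} \<times> {..N}"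
    by (auto simp: T_def)
  then have "finite (?S - T)"
    by (rule finite_subset) simp
  then have "(\<lambda>(i, m). W (i + m) * x ^ i * y ^ m) summable_on (?S - T)"
    by (rule summable_on_finite)
  with T have "(\<lambda>(i, m). W (i + m) * x ^ i * y ^ m) summable_on (T \<union> (?S - T))"
    by (rule summable_on_Un_disjoint) auto
  moreover have "T \<union> (?S - T) = ?S"
    by (auto simp: T_def)
  ultimately show ?thesis by simp
qed

lemma pair_weights_slices:
  fixes W :: "nat \<Rightarrow> complex"
  assumes s: "(\<lambda>(i, m). W (i + m) * x ^ i * y ^ m) summable_on {1..} \<times> UNIV" and "x \<noteq> 0"
  shows "(\<lambda>n. W n * x ^ n) summable_on UNIV" and "(\<lambda>n. W n * y ^ n) summable_on UNIV"
proof -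
  have "(\<lambda>(m, i). W (i + m) * x ^ i * y ^ m) summable_on UNIV \<times> {1..}"
    using s summable_on_swap[of "\<lambda>(i, m). W (i + m) * x ^ i * y ^ m" "{1..}" UNIV] by simp
  from summable_on_SigmaD1[OF this, of 0] show "(\<lambda>n. W n * x ^ n) summable_on UNIV"
    by (intro summable_on_nat_from_1) simp
  have bij: "bij_betw Suc UNIV {1..}"
    by (rule bij_betwI[of _ _ _ "\<lambda>n. n - 1"]) auto
  have "(\<lambda>m. W (1 + m) * x ^ 1 * y ^ m) summable_on UNIV"
    using summable_on_SigmaD1[OF s, of 1] by simp
  then have "(\<lambda>m. y / x * (W (1 + m) * x ^ 1 * y ^ m)) summable_on UNIV"
    by (rule summable_on_cmult_right)
  then have "(\<lambda>m. W (Suc m) * y ^ Suc m) summable_on UNIV"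
    using \<open>x \<noteq> 0\<close> by (simp add: mult_ac)
  then show "(\<lambda>n. W n * y ^ n) summable_on UNIV"
    using summable_on_reindex_bij_betw[OF bij, of "\<lambda>n. W n * y ^ n"]
    by (intro summable_on_nat_from_1) simp
qed

lemma linear_recursion_solution:
  fixes E \<kappa> :: "nat \<Rightarrow> complex"
  assumes E: "\<And>N. E (Suc N) = r * E N + c * \<kappa> (Suc N)"
  shows "E (M + s) = r ^ s * E M + c * (\<Sum>i=1..s. \<kappa> (M + i) * r ^ (s - i))"
proof (induction s)
  case (Suc s)
  have "(\<Sum>i=1..s. \<kappa> (M + i) * r ^ (Suc s - i)) = (\<Sum>i=1..s. r * (\<kappa> (M + i) * r ^ (s - i)))"
    by (rule sum.cong) (auto simp: Suc_diff_le)
  then have "(\<Sum>i=1..Suc s. \<kappa> (M + i) * r ^ (Suc s - i))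
      = r * (\<Sum>i=1..s. \<kappa> (M + i) * r ^ (s - i)) + \<kappa> (M + Suc s)"
    by (simp add: sum_distrib_left)
  then show ?case
    using E[of "M + s"] Suc.IH by (simp add: algebra_simps)
qed simp

text \<open>
  The coefficient of \<open>c\<close> that stems from \<open>\<kappa> (M + i)\<close> when a solution of \<open>E (N + 1) = r * E N + c * \<kappa> (N + 1)\<close> is unrolled
  down to \<open>E M\<close> and summed against \<open>W s * x ^ s * H (M + s)\<close>; here \<open>s = i + m\<close>, and the \<open>m\<close> later
  steps contribute the factor \<open>r ^ m\<close>.
\<close>

definition excursion ::
    "(nat \<Rightarrow> complex) \<Rightarrow> complex \<Rightarrow> complex \<Rightarrow> (nat \<Rightarrow> complex) \<Rightarrow> (nat \<Rightarrow> complex) \<Rightarrow> nat \<Rightarrow> nat \<Rightarrow> complex" where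
  "excursion W x r \<kappa> H M i = (\<Sum>\<^sub>\<infinity>m. W (i + m) * x ^ i * (x * r) ^ m * (\<kappa> (M + i) * H (M + i + m)))"

text \<open>
  The bound does not depend on \<open>M\<close>, which makes the outer summations below absolutely convergent.
\<close>

lemma excursion_bound:
  assumes s: "(\<lambda>(i, m). W (i + m) * x ^ i * (x * r) ^ m) summable_on {1..} \<times> UNIV"
    and \<kappa>: "\<And>n. norm (\<kappa> n) \<le> K1" and H: "\<And>n. norm (H n) \<le> K2"
  obtains b :: "nat \<Rightarrow> complex" where "b summable_on {1..}"
    and "\<And>M i. i \<in> {1..} \<Longrightarrow> norm (excursion W x r \<kappa> H M i) \<le> norm (b i)"
proof -
  define b where "b i = complex_of_real (K1 * K2 * (\<Sum>\<^sub>\<infinity>m. norm (W (i + m) * x ^ i * (x * r) ^ m)))" for i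
  have K: "0 \<le> K1" "0 \<le> K2"
    using order_trans[OF norm_ge_zero \<kappa>] order_trans[OF norm_ge_zero H] by auto
  have "(\<lambda>(i, m). norm (W (i + m) * x ^ i * (x * r) ^ m)) summable_on {1..} \<times> UNIV"
    using summable_on_norm_complex[OF s] by (simp add: case_prod_unfold)
  then have "(\<lambda>i. \<Sum>\<^sub>\<infinity>m. norm (W (i + m) * x ^ i * (x * r) ^ m)) summable_on {1..}"
    using summable_on_Sigma_banach[of "\<lambda>i m. norm (W (i + m) * x ^ i * (x * r) ^ m)" "{1..}" "\<lambda>_. UNIV"]
    by simp
  then have b: "b summable_on {1..}"
    unfolding b_def by (rule summable_on_of_real[OF summable_on_cmult_right])
  have "norm (excursion W x r \<kappa> H M i) \<le> norm (b i)" if "i \<in> {1..}" for M i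
  proof -
    have "norm (excursion W x r \<kappa> H M i) \<le> K1 * K2 * (\<Sum>\<^sub>\<infinity>m. norm (W (i + m) * x ^ i * (x * r) ^ m))"
      unfolding excursion_def
    proof (rule norm_infsum_mult_bounded_le)
      show "(\<lambda>m. W (i + m) * x ^ i * (x * r) ^ m) summable_on UNIV"
        using summable_on_SigmaD1[OF s that] by simp
      show "norm (\<kappa> (M + i) * H (M + i + m)) \<le> K1 * K2" for m
        unfolding norm_mult using \<kappa> H K by (intro mult_mono) auto
    qed
    also have "\<dots> \<le> norm (b i)"
      unfolding b_def norm_of_real by simp
    finally show ?thesis .
  qed
  with b show ?thesis
    by (intro that[of b])
qed

text \<open>
  Unrolling the recursion gives \<open>E (M + s) = r ^ s * E M + c * (\<Sum>i=1..s. \<kappa> (M + i) * r ^ (s - i))\<close>.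
  The first part turns the weights \<open>x ^ s\<close> into \<open>(x * r) ^ s\<close>, the second is summed along the
  triangle \<open>1 \<le> i \<le> s\<close>.
\<close>

lemma recursion_weighted_sum:
  assumes pair: "(\<lambda>(i, m). W (i + m) * x ^ i * (x * r) ^ m) summable_on {1..} \<times> UNIV" and x: "x \<noteq> 0"
    and \<kappa>: "\<And>n. norm (\<kappa> n) \<le> K1" and H: "\<And>n. norm (H n) \<le> K2"
    and E: "\<And>N. E (Suc N) = r * E N + c * \<kappa> (Suc N)"
  shows "(\<lambda>s. W s * x ^ s * (E (M + s) * H (M + s))) summable_on UNIV"
    and "(\<Sum>\<^sub>\<infinity>s. W s * x ^ s * (E (M + s) * H (M + s)))
          = E M * (\<Sum>\<^sub>\<infinity>s. W s * (x * r) ^ s * H (M + s)) + c * (\<Sum>\<^sub>\<infinity>i\<in>{1..}. excursion W x r \<kappa> H M i)"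
proof -
  define a where "a i m = W (i + m) * x ^ i * (x * r) ^ m * (\<kappa> (M + i) * H (M + i + m))" for i m
  have bound: "norm (\<kappa> i * H n) \<le> K1 * K2" for i n
    unfolding norm_mult using \<kappa>[of i] H[of n] by (intro mult_mono) (auto intro: order_trans[OF norm_ge_zero])
  have a: "(\<lambda>(i, m). a i m) summable_on {1..} \<times> UNIV"
    using summable_on_mult_bounded[OF pair, of "\<lambda>(i, m). \<kappa> (M + i) * H (M + i + m)" "K1 * K2"] bound
    by (simp add: a_def case_prod_unfold)
  have a_eq: "a i (s - i) = W s * x ^ s * H (M + s) * (\<kappa> (M + i) * r ^ (s - i))" if "i \<in> {1..s}" for i s
  proof -
    have "i + (s - i) = s" "M + i + (s - i) = M + s"
      using that by auto
    moreover have "x ^ i * x ^ (s - i) = x ^ s"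
      using that by (simp flip: power_add)
    then have "x ^ i * (x * r) ^ (s - i) = x ^ s * r ^ (s - i)"
      by (simp add: power_mult_distrib flip: mult.assoc)
    ultimately show ?thesis
      by (simp add: a_def mult_ac)
  qed
  have summand: "W s * x ^ s * (E (M + s) * H (M + s))
      = E M * (W s * (x * r) ^ s * H (M + s)) + c * (\<Sum>i=1..s. a i (s - i))" for s
  proof -
    have "(\<Sum>i=1..s. a i (s - i)) = W s * x ^ s * H (M + s) * (\<Sum>i=1..s. \<kappa> (M + i) * r ^ (s - i))"
      unfolding sum_distrib_left by (rule sum.cong[OF refl a_eq])
    then show ?thesis
      unfolding linear_recursion_solution[of E r c \<kappa>, OF E]
      by (simp add: power_mult_distrib algebra_simps)
  qed
  have s1: "(\<lambda>s. E M * (W s * (x * r) ^ s * H (M + s))) summable_on UNIV"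
    using summable_on_mult_bounded[OF pair_weights_slices(2)[OF pair x] H]
    by (intro summable_on_cmult_right)
  have s2: "(\<lambda>s. c * (\<Sum>i=1..s. a i (s - i))) summable_on UNIV"
    using infsum_triangle(1)[OF a] by (rule summable_on_cmult_right)
  show "(\<lambda>s. W s * x ^ s * (E (M + s) * H (M + s))) summable_on UNIV"
    unfolding summand using s1 s2 by (rule summable_on_add)
  show "(\<Sum>\<^sub>\<infinity>s. W s * x ^ s * (E (M + s) * H (M + s)))
          = E M * (\<Sum>\<^sub>\<infinity>s. W s * (x * r) ^ s * H (M + s)) + c * (\<Sum>\<^sub>\<infinity>i\<in>{1..}. excursion W x r \<kappa> H M i)"
    unfolding summand infsum_add[OF s1 s2] infsum_cmult_right' infsum_triangle(2)[OF a]
    by (simp add: excursion_def a_def[abs_def])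
qed

text \<open>
  Three weighted sums are taken one after the other, each moving the argument of \<open>u\<close> further along
  \<open>t * q ^ N\<close>. At each stage \<open>E\<close> is unrolled over the current index only, so that what remains is
  again of the form \<open>E M\<close> times a power series and can be fed into the next stage. The
  three families of leftover terms are the three sums on the right.
\<close>

lemma threefold_expansion:
  fixes A B C u V E \<kappa> :: "nat \<Rightarrow> complex"
  assumes q: "norm q < 1" and nz: "g \<noteq> 0" "e \<noteq> 0" "\<gamma> \<noteq> 0"
    and u: "(\<lambda>n. u n * t ^ n) summable_on UNIV"
    and V: "(\<lambda>n. V n * t ^ n) summable_on UNIV"
    and A: "(\<lambda>(i, m). A (i + m) * g ^ i * (g * r) ^ m) summable_on {1..} \<times> UNIV"
    and B: "(\<lambda>(i, m). B (i + m) * e ^ i * (e * r) ^ m) summable_on {1..} \<times> UNIV"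
    and C: "(\<lambda>(i, m). C (i + m) * \<gamma> ^ i * (\<gamma> * r) ^ m) summable_on {1..} \<times> UNIV"
    and factor: "\<And>N. psum u (t * q ^ N) = E N * psum V (t * q ^ N)"
    and E: "\<And>N. E (Suc N) = r * E N + c * \<kappa> (Suc N)"
    and \<kappa>: "\<And>n. norm (\<kappa> n) \<le> K"
  defines "V1 \<equiv> \<lambda>n. V n * psum A (g * r * q ^ n)"
  defines "V2 \<equiv> \<lambda>n. V1 n * psum B (e * r * q ^ n)"
  defines "V3 \<equiv> \<lambda>n. V2 n * psum C (\<gamma> * r * q ^ n)"
  shows "psum (\<lambda>n. u n * psum A (g * q ^ n) * psum B (e * q ^ n) * psum C (\<gamma> * q ^ n)) t
    = E 0 * psum V3 t
      + c * ((\<Sum>\<^sub>\<infinity>i\<in>{1..}. excursion C \<gamma> r \<kappa> (\<lambda>N. psum V2 (t * q ^ N)) 0 i)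
           + (\<Sum>\<^sub>\<infinity>i\<in>{1..}. \<Sum>\<^sub>\<infinity>k. C k * \<gamma> ^ k * excursion B e r \<kappa> (\<lambda>N. psum V1 (t * q ^ N)) k i)
           + (\<Sum>\<^sub>\<infinity>i\<in>{1..}. \<Sum>\<^sub>\<infinity>j. B j * e ^ j *
                (\<Sum>\<^sub>\<infinity>k. C k * \<gamma> ^ k * excursion A g r \<kappa> (\<lambda>N. psum V (t * q ^ N)) (k + j) i)))"
proof -
  define \<Phi> where "\<Phi> N = psum V (t * q ^ N)" for N
  define \<Phi>1 where "\<Phi>1 N = psum V1 (t * q ^ N)" for N
  define \<Phi>2 where "\<Phi>2 N = psum V2 (t * q ^ N)" for N
  define u1 where "u1 n = u n * psum A (g * q ^ n)" for n
  define u2 where "u2 n = u1 n * psum B (e * q ^ n)" for n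
  define exA where "exA = excursion A g r \<kappa> \<Phi>"
  define exB where "exB = excursion B e r \<kappa> \<Phi>1"
  define exC where "exC = excursion C \<gamma> r \<kappa> \<Phi>2"
  define RA where "RA M = (\<Sum>\<^sub>\<infinity>i\<in>{1..}. exA M i)" for M
  define RB where "RB M = (\<Sum>\<^sub>\<infinity>i\<in>{1..}. exB M i)" for M
  define SB where "SB M = (\<Sum>\<^sub>\<infinity>j. B j * e ^ j * RA (M + j))" for M
  note slA = pair_weights_slices[OF A nz(1)]
  note slB = pair_weights_slices[OF B nz(2)]
  note slC = pair_weights_slices[OF C nz(3)]
  have pow: "norm (q ^ N) \<le> 1" for N
    using q by (simp add: norm_power power_le_one)

  have V1: "(\<lambda>n. V1 n * t ^ n) summable_on UNIV"
    unfolding V1_def by (rule psum_of_psums(3)[OF q slA(2) V])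
  have V2: "(\<lambda>n. V2 n * t ^ n) summable_on UNIV"
    unfolding V2_def by (rule psum_of_psums(3)[OF q slB(2) V1])
  have u1: "(\<lambda>n. u1 n * t ^ n) summable_on UNIV"
    unfolding u1_def by (rule psum_of_psums(3)[OF q slA(1) u])
  have u2: "(\<lambda>n. u2 n * t ^ n) summable_on UNIV"
    unfolding u2_def by (rule psum_of_psums(3)[OF q slB(1) u1])
  obtain K0 where K0: "norm (\<Phi> N) \<le> K0" for N
    unfolding \<Phi>_def using psum_shrink_bound[OF V pow] by blast
  obtain K1 where K1: "norm (\<Phi>1 N) \<le> K1" for N
    unfolding \<Phi>1_def using psum_shrink_bound[OF V1 pow] by blast
  obtain K2 where K2: "norm (\<Phi>2 N) \<le> K2" for N
    unfolding \<Phi>2_def using psum_shrink_bound[OF V2 pow] by blast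
  obtain bA :: "nat \<Rightarrow> complex" where bA: "bA summable_on {1..}"
    and exA: "\<And>M i. i \<in> {1..} \<Longrightarrow> norm (exA M i) \<le> norm (bA i)"
    unfolding exA_def using excursion_bound[where \<kappa> = \<kappa> and H = \<Phi>, OF A \<kappa> K0] by metis
  obtain bB :: "nat \<Rightarrow> complex" where bB: "bB summable_on {1..}"
    and exB: "\<And>M i. i \<in> {1..} \<Longrightarrow> norm (exB M i) \<le> norm (bB i)"
    unfolding exB_def using excursion_bound[where \<kappa> = \<kappa> and H = \<Phi>1, OF B \<kappa> K1] by metis

  have first: "psum u1 (t * q ^ M) = E M * \<Phi>1 M + c * RA M" for M
  proof -
    have "psum u1 (t * q ^ M) = (\<Sum>\<^sub>\<infinity>s. A s * g ^ s * (E (M + s) * \<Phi> (M + s)))"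
      unfolding u1_def psum_of_psums(1)[OF q slA(1) u, symmetric] factor \<Phi>_def ..
    also have "\<dots> = E M * (\<Sum>\<^sub>\<infinity>s. A s * (g * r) ^ s * \<Phi> (M + s)) + c * RA M"
      unfolding RA_def exA_def by (rule recursion_weighted_sum(2)[where \<kappa> = \<kappa> and H = \<Phi> and E = E, OF A nz(1) \<kappa> K0 E])
    also have "(\<Sum>\<^sub>\<infinity>s. A s * (g * r) ^ s * \<Phi> (M + s)) = \<Phi>1 M"
      unfolding \<Phi>_def \<Phi>1_def V1_def by (rule psum_of_psums(1)[OF q slA(2) V])
    finally show ?thesis .
  qed
  have RA_bound: "norm (RA M) \<le> (\<Sum>\<^sub>\<infinity>i\<in>{1..}. norm (bA i))" for M
  proof -
    have s: "exA M summable_on {1..}"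
      using bA by (rule summable_on_comparison_complex[where K = 1]) (use exA in auto)
    then have "norm (RA M) \<le> (\<Sum>\<^sub>\<infinity>i\<in>{1..}. norm (exA M i))"
      unfolding RA_def by (rule norm_infsum_complex_le)
    also have "\<dots> \<le> (\<Sum>\<^sub>\<infinity>i\<in>{1..}. norm (bA i))"
      by (intro infsum_mono summable_on_norm_complex s bA exA)
    finally show ?thesis .
  qed

  have sumB: "(\<lambda>j. B j * e ^ j * RA (M + j)) summable_on UNIV" for M
    using slB(1) RA_bound by (rule summable_on_mult_bounded)
  have second: "psum u2 (t * q ^ M) = E M * \<Phi>2 M + c * (RB M + SB M)" for M
  proof -
    have "psum u2 (t * q ^ M)
        = (\<Sum>\<^sub>\<infinity>j. B j * e ^ j * (E (M + j) * \<Phi>1 (M + j)) + c * (B j * e ^ j * RA (M + j)))"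
      unfolding u2_def psum_of_psums(1)[OF q slB(1) u1, symmetric] first
      by (simp only: distrib_left mult.left_commute[of _ c] mult.assoc)
    also have "\<dots> = (\<Sum>\<^sub>\<infinity>j. B j * e ^ j * (E (M + j) * \<Phi>1 (M + j))) + c * SB M"
      unfolding SB_def infsum_cmult_right'[symmetric]
      by (intro infsum_add recursion_weighted_sum(1)[where \<kappa> = \<kappa> and H = \<Phi>1 and E = E, OF B nz(2) \<kappa> K1 E] summable_on_cmult_right sumB)
    also have "(\<Sum>\<^sub>\<infinity>j. B j * e ^ j * (E (M + j) * \<Phi>1 (M + j)))
        = E M * (\<Sum>\<^sub>\<infinity>j. B j * (e * r) ^ j * \<Phi>1 (M + j)) + c * RB M"
      unfolding RB_def exB_def by (rule recursion_weighted_sum(2)[where \<kappa> = \<kappa> and H = \<Phi>1 and E = E, OF B nz(2) \<kappa> K1 E])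
    also have "(\<Sum>\<^sub>\<infinity>j. B j * (e * r) ^ j * \<Phi>1 (M + j)) = \<Phi>2 M"
      unfolding \<Phi>1_def \<Phi>2_def V2_def by (rule psum_of_psums(1)[OF q slB(2) V1])
    finally show ?thesis
      by (simp add: algebra_simps)
  qed

  have ki: "(\<lambda>(k, i). C k * \<gamma> ^ k * exB k i) summable_on UNIV \<times> {1..}"
    using summable_on_times_complex[OF slC(1) bB]
    by (rule summable_on_comparison_complex[where K = 1])
      (use exB in \<open>auto simp: norm_mult intro!: mult_left_mono\<close>)
  have kji: "(\<lambda>(k, j, i). C k * \<gamma> ^ k * (B j * e ^ j * exA (k + j) i)) summable_on UNIV \<times> UNIV \<times> {1..}"
    using summable_on_times_complex[OF slC(1) summable_on_times_complex[OF slB(1) bA]]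
    by (rule summable_on_comparison_complex[where K = 1])
      (use exA in \<open>auto simp: norm_mult intro!: mult_left_mono\<close>)
  from summable_on_Sigma_banach[OF ki]
  have sRB: "(\<lambda>k. C k * \<gamma> ^ k * RB k) summable_on UNIV"
    unfolding RB_def by (simp add: infsum_cmult_right')
  have SB_bound: "norm (SB M) \<le> (\<Sum>\<^sub>\<infinity>i\<in>{1..}. norm (bA i)) * (\<Sum>\<^sub>\<infinity>j. norm (B j * e ^ j))" for M
    unfolding SB_def using slB(1) RA_bound by (rule norm_infsum_mult_bounded_le)
  have sSB: "(\<lambda>k. C k * \<gamma> ^ k * SB k) summable_on UNIV"
    using slC(1) SB_bound by (rule summable_on_mult_bounded)

  have "psum (\<lambda>n. u2 n * psum C (\<gamma> * q ^ n)) (t * q ^ 0)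
      = (\<Sum>\<^sub>\<infinity>k. C k * \<gamma> ^ k * (E (0 + k) * \<Phi>2 (0 + k))
            + c * (C k * \<gamma> ^ k * RB k + C k * \<gamma> ^ k * SB k))"
    unfolding psum_of_psums(1)[OF q slC(1) u2, symmetric] second
    by (simp only: distrib_left mult.left_commute[of _ c] mult.assoc add_0_left)
  also have "\<dots> = (\<Sum>\<^sub>\<infinity>k. C k * \<gamma> ^ k * (E (0 + k) * \<Phi>2 (0 + k)))
      + c * (\<Sum>\<^sub>\<infinity>k. C k * \<gamma> ^ k * RB k + C k * \<gamma> ^ k * SB k)"
    unfolding infsum_cmult_right'[symmetric]
    by (intro infsum_add recursion_weighted_sum(1)[where \<kappa> = \<kappa> and H = \<Phi>2 and E = E, OF C nz(3) \<kappa> K2 E] summable_on_cmult_right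
        summable_on_add sRB sSB)
  also have "(\<Sum>\<^sub>\<infinity>k. C k * \<gamma> ^ k * RB k + C k * \<gamma> ^ k * SB k)
      = (\<Sum>\<^sub>\<infinity>k. C k * \<gamma> ^ k * RB k) + (\<Sum>\<^sub>\<infinity>k. C k * \<gamma> ^ k * SB k)"
    by (rule infsum_add[OF sRB sSB])
  also have "(\<Sum>\<^sub>\<infinity>k. C k * \<gamma> ^ k * (E (0 + k) * \<Phi>2 (0 + k)))
      = E 0 * (\<Sum>\<^sub>\<infinity>k. C k * (\<gamma> * r) ^ k * \<Phi>2 (0 + k)) + c * (\<Sum>\<^sub>\<infinity>i\<in>{1..}. exC 0 i)"
    unfolding exC_def by (rule recursion_weighted_sum(2)[where \<kappa> = \<kappa> and H = \<Phi>2 and E = E, OF C nz(3) \<kappa> K2 E])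
  also have "(\<Sum>\<^sub>\<infinity>k. C k * (\<gamma> * r) ^ k * \<Phi>2 (0 + k)) = psum V3 (t * q ^ 0)"
    unfolding \<Phi>2_def V3_def by (rule psum_of_psums(1)[OF q slC(2) V2])
  also have "(\<Sum>\<^sub>\<infinity>k. C k * \<gamma> ^ k * RB k) = (\<Sum>\<^sub>\<infinity>i\<in>{1..}. \<Sum>\<^sub>\<infinity>k. C k * \<gamma> ^ k * exB k i)"
    unfolding RB_def infsum_cmult_right'[symmetric] by (rule infsum_swap_banach[OF ki])
  also have "(\<Sum>\<^sub>\<infinity>k. C k * \<gamma> ^ k * SB k)
      = (\<Sum>\<^sub>\<infinity>k. \<Sum>\<^sub>\<infinity>j. \<Sum>\<^sub>\<infinity>i\<in>{1..}. C k * \<gamma> ^ k * (B j * e ^ j * exA (k + j) i))"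
    unfolding SB_def RA_def infsum_cmult_right' ..
  also have "\<dots> = (\<Sum>\<^sub>\<infinity>i\<in>{1..}. \<Sum>\<^sub>\<infinity>j. \<Sum>\<^sub>\<infinity>k. C k * \<gamma> ^ k * (B j * e ^ j * exA (k + j) i))"
    by (rule infsum_reverse_three[OF kji])
  also have "\<dots> = (\<Sum>\<^sub>\<infinity>i\<in>{1..}. \<Sum>\<^sub>\<infinity>j. B j * e ^ j * (\<Sum>\<^sub>\<infinity>k. C k * \<gamma> ^ k * exA (k + j) i))"
    unfolding infsum_cmult_right'[symmetric] by (simp only: mult_ac)
  finally have "psum (\<lambda>n. u2 n * psum C (\<gamma> * q ^ n)) t
      = E 0 * psum V3 t + c * ((\<Sum>\<^sub>\<infinity>i\<in>{1..}. exC 0 i)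
           + (\<Sum>\<^sub>\<infinity>i\<in>{1..}. \<Sum>\<^sub>\<infinity>k. C k * \<gamma> ^ k * exB k i)
           + (\<Sum>\<^sub>\<infinity>i\<in>{1..}. \<Sum>\<^sub>\<infinity>j. B j * e ^ j * (\<Sum>\<^sub>\<infinity>k. C k * \<gamma> ^ k * exA (k + j) i)))"
    by (simp only: power_0 mult_1_right distrib_left add.assoc)
  then show ?thesis
    unfolding exA_def exB_def exC_def u2_def u1_def \<Phi>_def \<Phi>1_def \<Phi>2_def .
qed

section \<open>The expansion of the series\<close>

lemma summable_on_compose_inj:
  fixes f :: "'a \<Rightarrow> complex"
  assumes "f summable_on S" "inj_on \<phi> T" "\<phi> ` T \<subseteq> S"
  shows "(\<lambda>x. f (\<phi> x)) summable_on T"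
proof -
  have "f summable_on \<phi> ` T"
    using assms(1,3) by (rule summable_on_subset_banach)
  then show ?thesis
    using summable_on_reindex[OF assms(2), of f] by (simp add: o_def)
qed

lemma summable_on_mult_ratio:
  assumes "norm q < 1" "X summable_on UNIV" "\<And>n. qpoch q b n \<noteq> 0"
  shows "(\<lambda>n. X n * (qpoch q a n / qpoch q b n)) summable_on UNIV"
proof -
  obtain K where "\<And>n. norm (qpoch q a n / qpoch q b n) \<le> K"
    using qpoch_ratio_bounded[OF assms(1,3)] by blast
  with assms(2) show ?thesis
    by (rule summable_on_mult_bounded)
qed

lemma summable_on_cancel_ratio:
  assumes q: "norm q < 1" and s: "(\<lambda>n. X n * (qpoch q a n / qpoch q b n)) summable_on UNIV"
    and nz: "\<And>n. qpoch q a n \<noteq> 0" "\<And>n. qpoch q b n \<noteq> 0"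
  shows "X summable_on UNIV"
  using summable_on_mult_ratio[OF q s nz(1), of b] nz by simp

lemma psum_cmult: "psum (\<lambda>n. K * V n) z = K * psum V z"
  unfolding psum_def mult.assoc infsum_cmult_right' ..

lemma qcoeff_add:
  "qcoeff q a (p + m) = qpoch q a p / qpoch q q p * (qpoch q (a * q ^ p) m / qpoch q (q ^ (p + 1)) m)"
  by (simp add: qcoeff_def qpoch_add)

text \<open>
  Each side is a quotient of infinite products with common tails. The right-hand side separates the
  dependence on \<open>p\<close> from that on \<open>p + m\<close>.
\<close>

lemma qpoch_quotient_as_tails:
  assumes q: "norm q < 1" and nz: "qpoch_inf q t \<noteq> 0" "qpoch_inf q y \<noteq> 0"
  shows "qpoch q (t * q ^ p) m / qpoch q (y * q ^ p) (m + 1)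
    = qpoch_inf q (t * q ^ p) / qpoch_inf q (y * q ^ p)
      * (qpoch_inf q (y * q ^ (p + m + 1)) / qpoch_inf q (t * q ^ (p + m)))"
proof -
  have "qpoch_inf q (t * q ^ p) = qpoch q (t * q ^ p) m * qpoch_inf q (t * q ^ (p + m))"
    using qpoch_inf_split[OF q, of "t * q ^ p" m] by (simp add: power_add mult_ac)
  moreover have "qpoch_inf q (y * q ^ p) = qpoch q (y * q ^ p) (m + 1) * qpoch_inf q (y * q ^ (p + m + 1))"
    using qpoch_inf_split[OF q, of "y * q ^ p" "m + 1"] by (simp add: power_add mult_ac)
  ultimately show ?thesis
    using qpoch_nonzero_if_inf(2)[OF q nz(1), of "p + m"] qpoch_nonzero_if_inf(2)[OF q nz(2), of "p + m + 1"]
    by (simp only: nonzero_mult_div_cancel_right times_divide_times_eq mult.assoc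
        mult_divide_mult_cancel_right mult.left_commute) simp
qed

text \<open>
  The functional equation of \<open>F N = psum (qratio q \<alpha> \<beta>) (t * q ^ N)\<close> relates \<open>F (N + 1)\<close> to \<open>F N\<close> with
  a coefficient that depends on \<open>N\<close>. Dividing by the infinite product that solves the homogeneous
  equation up to powers of \<open>q / \<beta>\<close> leaves the constant coefficient \<open>q / \<beta>\<close>.
\<close>

lemma quotient_recursion:
  assumes q: "norm q < 1" and \<beta>: "\<beta> \<noteq> 0" "\<And>n. qpoch q \<beta> n \<noteq> 0"
    and nz: "qpoch_inf q t \<noteq> 0" "qpoch_inf q (\<alpha> * t / \<beta>) \<noteq> 0"
    and s: "(\<lambda>n. qratio q \<alpha> \<beta> n * t ^ n) summable_on UNIV"
  defines "E \<equiv> \<lambda>N. psum (qratio q \<alpha> \<beta>) (t * q ^ N)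
      * (qpoch_inf q (t * q ^ N) / qpoch_inf q (\<alpha> * t / \<beta> * q ^ (N + 1)))"
  shows "E (Suc N) = q / \<beta> * E N
      + (1 - q / \<beta>) * (qpoch_inf q (t * q ^ Suc N) / qpoch_inf q (\<alpha> * t / \<beta> * q ^ Suc N))"
proof -
  define x where "x = t * q ^ N"
  define w where "w = \<alpha> * x * q / \<beta>"
  define F where "F = psum (qratio q \<alpha> \<beta>) x"
  define F' where "F' = psum (qratio q \<alpha> \<beta>) (x * q)"
  have "(\<lambda>n. qratio q \<alpha> \<beta> n * x ^ n) summable_on UNIV"
    unfolding x_def using s q by (intro psum_shrink_summable) (auto simp: norm_power power_le_one)
  then have "q * (1 - x) * F - (\<beta> - \<alpha> * x * q) * F' = q - \<beta>"
    unfolding F_def F'_def by (rule qratio_functional_equation[OF q \<beta>(2)])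
  then have eq: "(\<beta> - \<alpha> * x * q) * F' = q * (1 - x) * F + (\<beta> - q)"
    by (simp only: algebra_simps)
  have "\<beta> * ((1 - w) * F') = (\<beta> - \<alpha> * x * q) * F'"
    using \<beta>(1) by (simp add: w_def right_diff_distrib left_diff_distrib)
  also have "\<dots> = \<beta> * (q / \<beta> * (1 - x) * F + (1 - q / \<beta>))"
    unfolding eq using \<beta>(1) by (simp add: distrib_left right_diff_distrib)
  finally have fe: "(1 - w) * F' = q / \<beta> * (1 - x) * F + (1 - q / \<beta>)"
    using \<beta>(1) by simp
  have xq: "t * q ^ Suc N = x * q" and wq: "\<alpha> * t / \<beta> * q ^ Suc N = w" "\<alpha> * t / \<beta> * q ^ (Suc N + 1) = w * q"
    "\<alpha> * t / \<beta> * q ^ (N + 1) = w"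
    by (simp_all add: x_def w_def)
  define T where "T = qpoch_inf q (x * q)"
  define Y where "Y = qpoch_inf q (w * q)"
  have split: "qpoch_inf q x = (1 - x) * T" "qpoch_inf q w = (1 - w) * Y"
    unfolding T_def Y_def by (rule qpoch_inf_split_first[OF q])+
  have "qpoch_inf q w \<noteq> 0"
    using qpoch_nonzero_if_inf(2)[OF q nz(2), of "Suc N"] unfolding wq .
  then have nzw: "1 - w \<noteq> 0" "Y \<noteq> 0"
    unfolding split by auto
  have "E (Suc N) = F' * (T / Y)"
    unfolding E_def xq wq F'_def T_def Y_def ..
  also have "\<dots> = ((1 - w) * F') * T / ((1 - w) * Y)"
    using nzw by simp
  also have "\<dots> = q / \<beta> * (F * ((1 - x) * T / ((1 - w) * Y))) + (1 - q / \<beta>) * (T / ((1 - w) * Y))"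
  proof -
    have "(a * b * F + d) * T / Z = a * (F * (b * T / Z)) + d * (T / Z)" for a b d Z :: complex
      by (simp add: add_divide_distrib algebra_simps)
    then show ?thesis
      unfolding fe .
  qed
  finally show ?thesis
    unfolding E_def xq wq x_def[symmetric] F_def[symmetric] split T_def[symmetric] Y_def[symmetric] .
qed

theorem theorem1p3:
  fixes q \<alpha> \<beta> \<gamma> \<delta> e f g h t :: complex
  assumes norm_q: "norm q < 1"
    and excluded: "\<forall>j::nat. \<forall>x\<in>{\<beta>, \<delta>, f, h, t}. x \<noteq> q powi (- int j)"
    \<comment> \<open>no denominator vanishes\<close>
    and nonzero: "q \<noteq> 0" "\<alpha> \<noteq> 0" "\<beta> \<noteq> 0" "\<gamma> \<noteq> 0" "e \<noteq> 0" "g \<noteq> 0" "t \<noteq> 0"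
    and denom_inf: "\<forall>x\<in>{h, f, \<delta>, q/\<alpha>, \<beta>, \<beta>/(\<alpha>*t), \<alpha>*t*q/\<beta>, \<alpha>*t/\<beta>, \<gamma>*q/\<beta>, e*q/\<beta>, g*q/\<beta>}.
                      qpoch_inf q x \<noteq> 0"
    and denom_fin: "\<forall>x\<in>{\<beta>, \<delta>, f, h, t, q, \<delta>*q/\<beta>, f*q/\<beta>, h*q/\<beta>, \<beta>*q/(\<alpha>*t)}.
                      \<forall>n. qpoch q x n \<noteq> 0"
    and denom_shifted: "\<forall>i n. qpoch q (q^(i+1)) n \<noteq> 0 \<and> qpoch q (t*q^i) n \<noteq> 0
                      \<and> qpoch q (\<alpha>*t*q^i/\<beta>) n \<noteq> 0"
    \<comment> \<open>the simple series converge absolutely\<close>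
    and conv_lhs: "(\<lambda>n. qpochs q [\<alpha>, \<gamma>, e, g] n / qpochs q [\<beta>, \<delta>, f, h] n * t^n)
                      abs_conv_on UNIV"
    and conv_4phi3: "qhyp_converges q [\<alpha>*q/\<beta>, \<gamma>*q/\<beta>, e*q/\<beta>, g*q/\<beta>] [\<delta>*q/\<beta>, f*q/\<beta>, h*q/\<beta>] t"
    and conv_2phi1: "qhyp_converges q [q, q/t] [\<beta>*q/(\<alpha>*t)] (q/\<alpha>)"
    \<comment> \<open>the double series and its inner series converge absolutely\<close>
    and conv_3phi2: "\<forall>p k::nat. qhyp_converges q [\<alpha>*q/\<beta>, e*q/\<beta>, g*q/\<beta>] [f*q/\<beta>, h*q/\<beta>] (t*q^(p+k))"
    and conv_double_k: "\<forall>p::nat.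
          (\<lambda>k. qpoch q (\<delta>*q^p/\<gamma>) k * (\<gamma>*q/\<beta>)^k / qpoch q (q^(p+1)) k
               * qhyp q [\<alpha>*q/\<beta>, e*q/\<beta>, g*q/\<beta>] [f*q/\<beta>, h*q/\<beta>] (t*q^(p+k)))
          abs_conv_on UNIV"
    and conv_double:
         "(\<lambda>(p, k). qpochs q [\<delta>/\<gamma>, \<alpha>*t/\<beta>] p * \<gamma>^p / qpochs q [t, q] p
               * (qpoch q (\<delta>*q^p/\<gamma>) k * (\<gamma>*q/\<beta>)^k / qpoch q (q^(p+1)) k
               * qhyp q [\<alpha>*q/\<beta>, e*q/\<beta>, g*q/\<beta>] [f*q/\<beta>, h*q/\<beta>] (t*q^(p+k))))
          abs_conv_on (UNIV \<times> UNIV)"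
    \<comment> \<open>the triple series and its inner series converge absolutely\<close>
    and conv_2phi1': "\<forall>p\<ge>1. \<forall>k j::nat. qhyp_converges q [\<alpha>*q/\<beta>, g*q/\<beta>] [h*q/\<beta>] (t*q^(p+k+j))"
    and conv_triple_j: "\<forall>p\<ge>1. \<forall>k::nat.
          (\<lambda>j. qpoch q (f*q^p/e) j * (e*q/\<beta>)^j / qpoch q (q^(p+1)) j
               * qhyp q [\<alpha>*q/\<beta>, g*q/\<beta>] [h*q/\<beta>] (t*q^(p+k+j)))
          abs_conv_on UNIV"
    and conv_triple_kj: "\<forall>p\<ge>1.
          (\<lambda>(k, j). qpochs q [\<delta>/\<gamma>, \<alpha>*t*q^p/\<beta>] k * \<gamma>^k / qpochs q [q, t*q^p] k
               * (qpoch q (f*q^p/e) j * (e*q/\<beta>)^j / qpoch q (q^(p+1)) j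
               * qhyp q [\<alpha>*q/\<beta>, g*q/\<beta>] [h*q/\<beta>] (t*q^(p+k+j))))
          abs_conv_on (UNIV \<times> UNIV)"
    and conv_triple:
         "(\<lambda>(p, k, j). qpochs q [f/e, \<alpha>*t/\<beta>] p * e^p / qpochs q [t, q] p
               * (qpochs q [\<delta>/\<gamma>, \<alpha>*t*q^p/\<beta>] k * \<gamma>^k / qpochs q [q, t*q^p] k
               * (qpoch q (f*q^p/e) j * (e*q/\<beta>)^j / qpoch q (q^(p+1)) j
               * qhyp q [\<alpha>*q/\<beta>, g*q/\<beta>] [h*q/\<beta>] (t*q^(p+k+j)))))
          abs_conv_on ({1..} \<times> UNIV \<times> UNIV)"
    \<comment> \<open>the quadruple series and its inner series converge absolutely\<close>
    and conv_quad_m: "\<forall>p\<ge>1. \<forall>j k::nat.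
          (\<lambda>m. qpoch q (h*q^p/g) m * qpoch q (t*q^(p+k+j)) m
               / (qpoch q (q^(p+1)) m * qpoch q (\<alpha>*t*q^(p+k+j)/\<beta>) (m+1)) * (g*q/\<beta>)^m)
          abs_conv_on UNIV"
    and conv_quad_km: "\<forall>p\<ge>1. \<forall>j::nat.
          (\<lambda>(k, m). qpoch q (\<delta>/\<gamma>) k * \<gamma>^k / qpoch q q k
               * (qpoch q (h*q^p/g) m * qpoch q (t*q^(p+k+j)) m
               / (qpoch q (q^(p+1)) m * qpoch q (\<alpha>*t*q^(p+k+j)/\<beta>) (m+1)) * (g*q/\<beta>)^m))
          abs_conv_on (UNIV \<times> UNIV)"
    and conv_quad_jkm: "\<forall>p\<ge>1.
          (\<lambda>(j, k, m). qpoch q (f/e) j * e^j / qpoch q q j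
               * (qpoch q (\<delta>/\<gamma>) k * \<gamma>^k / qpoch q q k
               * (qpoch q (h*q^p/g) m * qpoch q (t*q^(p+k+j)) m
               / (qpoch q (q^(p+1)) m * qpoch q (\<alpha>*t*q^(p+k+j)/\<beta>) (m+1)) * (g*q/\<beta>)^m)))
          abs_conv_on (UNIV \<times> UNIV \<times> UNIV)"
    and conv_quad:
         "(\<lambda>(p, j, k, m). qpoch q (h/g) p * g^p / qpoch q q p
               * (qpoch q (f/e) j * e^j / qpoch q q j
               * (qpoch q (\<delta>/\<gamma>) k * \<gamma>^k / qpoch q q k
               * (qpoch q (h*q^p/g) m * qpoch q (t*q^(p+k+j)) m
               / (qpoch q (q^(p+1)) m * qpoch q (\<alpha>*t*q^(p+k+j)/\<beta>) (m+1)) * (g*q/\<beta>)^m))))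
          abs_conv_on ({1..} \<times> UNIV \<times> UNIV \<times> UNIV)"
  shows
    "(\<Sum>\<^sub>\<infinity>n. qpochs q [\<alpha>, \<gamma>, e, g] n / qpochs q [\<beta>, \<delta>, f, h] n * t^n)
     = qpochs_inf q [g, e, \<gamma>, \<beta>/\<alpha>, q, \<alpha>*t, q/(\<alpha>*t), \<delta>*q/\<beta>, f*q/\<beta>, h*q/\<beta>]
         / qpochs_inf q [h, f, \<delta>, q/\<alpha>, \<beta>, \<beta>/(\<alpha>*t), \<alpha>*t*q/\<beta>, \<gamma>*q/\<beta>, e*q/\<beta>, g*q/\<beta>]
         * qhyp q [\<alpha>*q/\<beta>, \<gamma>*q/\<beta>, e*q/\<beta>, g*q/\<beta>] [\<delta>*q/\<beta>, f*q/\<beta>, h*q/\<beta>] t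
     + (1 - q/\<beta>)
         * (qpochs_inf q [g, e, \<gamma>, t, \<delta>*q/\<beta>, f*q/\<beta>, h*q/\<beta>]
            / qpochs_inf q [h, f, \<delta>, \<alpha>*t/\<beta>, \<gamma>*q/\<beta>, e*q/\<beta>, g*q/\<beta>])
         * qhyp q [\<alpha>*q/\<beta>, \<gamma>*q/\<beta>, e*q/\<beta>, g*q/\<beta>] [\<delta>*q/\<beta>, f*q/\<beta>, h*q/\<beta>] t
         * (qhyp q [q, q/t] [\<beta>*q/(\<alpha>*t)] (q/\<alpha>) - 1)
     + (1 - q/\<beta>)
         * (qpochs_inf q [g, e, \<gamma>, t, f*q/\<beta>, h*q/\<beta>]
            / qpochs_inf q [h, f, \<delta>, \<alpha>*t/\<beta>, e*q/\<beta>, g*q/\<beta>])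
         * (\<Sum>\<^sub>\<infinity>p. qpochs q [\<delta>/\<gamma>, \<alpha>*t/\<beta>] p * \<gamma>^p / qpochs q [t, q] p
             * (\<Sum>\<^sub>\<infinity>k. qpoch q (\<delta>*q^p/\<gamma>) k * (\<gamma>*q/\<beta>)^k / qpoch q (q^(p+1)) k
                 * qhyp q [\<alpha>*q/\<beta>, e*q/\<beta>, g*q/\<beta>] [f*q/\<beta>, h*q/\<beta>] (t*q^(p+k))))
     + (1 - q/\<beta>)
         * (qpochs_inf q [g, e, \<gamma>, t, h*q/\<beta>]
            / qpochs_inf q [h, f, \<delta>, \<alpha>*t/\<beta>, g*q/\<beta>])
         * (\<Sum>\<^sub>\<infinity>p\<in>{1..}. qpochs q [f/e, \<alpha>*t/\<beta>] p * e^p / qpochs q [t, q] p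
             * (\<Sum>\<^sub>\<infinity>k. qpochs q [\<delta>/\<gamma>, \<alpha>*t*q^p/\<beta>] k * \<gamma>^k / qpochs q [q, t*q^p] k
                 * (\<Sum>\<^sub>\<infinity>j. qpoch q (f*q^p/e) j * (e*q/\<beta>)^j / qpoch q (q^(p+1)) j
                     * qhyp q [\<alpha>*q/\<beta>, g*q/\<beta>] [h*q/\<beta>] (t*q^(p+k+j)))))
     + (1 - q/\<beta>)
         * (qpochs_inf q [g, e, \<gamma>] / qpochs_inf q [h, f, \<delta>])
         * (\<Sum>\<^sub>\<infinity>p\<in>{1..}. qpoch q (h/g) p * g^p / qpoch q q p
             * (\<Sum>\<^sub>\<infinity>j. qpoch q (f/e) j * e^j / qpoch q q j
                 * (\<Sum>\<^sub>\<infinity>k. qpoch q (\<delta>/\<gamma>) k * \<gamma>^k / qpoch q q k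
                     * (\<Sum>\<^sub>\<infinity>m. qpoch q (h*q^p/g) m * qpoch q (t*q^(p+k+j)) m
                          / (qpoch q (q^(p+1)) m * qpoch q (\<alpha>*t*q^(p+k+j)/\<beta>) (m+1))
                          * (g*q/\<beta>)^m))))"
proof -
  define r where "r = q / \<beta>"
  define y where "y = \<alpha> * t / \<beta>"
  define A where "A = qcoeff q (h / g)"
  define B where "B = qcoeff q (f / e)"
  define C where "C = qcoeff q (\<delta> / \<gamma>)"
  define V where "V = qcoeff q (\<alpha> * q / \<beta>)"
  define u where "u = qratio q \<alpha> \<beta>"
  define Wg where "Wg n = qpoch q (g * q / \<beta>) n / qpoch q (h * q / \<beta>) n" for n
  define We where "We n = qpoch q (e * q / \<beta>) n / qpoch q (f * q / \<beta>) n" for n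
  define Wc where "Wc n = qpoch q (\<gamma> * q / \<beta>) n / qpoch q (\<delta> * q / \<beta>) n" for n
  define \<kappa> where "\<kappa> N = qpoch_inf q (t * q ^ N) / qpoch_inf q (y * q ^ N)" for N
  define \<Phi> where "\<Phi> N = psum V (t * q ^ N)" for N
  define H2 where "H2 N = psum (\<lambda>n. V n * Wg n) (t * q ^ N)" for N
  define H3 where "H3 N = psum (\<lambda>n. V n * Wg n * We n) (t * q ^ N)" for N
  define H4 where "H4 = psum (\<lambda>n. V n * Wg n * We n * Wc n) t"
  define \<rho>g where "\<rho>g = qpoch_inf q (h * q / \<beta>) / qpoch_inf q (g * q / \<beta>)"
  define \<rho>e where "\<rho>e = qpoch_inf q (f * q / \<beta>) / qpoch_inf q (e * q / \<beta>)"
  define \<rho>c where "\<rho>c = qpoch_inf q (\<delta> * q / \<beta>) / qpoch_inf q (\<gamma> * q / \<beta>)"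

  have inf: "qpoch_inf q h \<noteq> 0" "qpoch_inf q f \<noteq> 0" "qpoch_inf q \<delta> \<noteq> 0" "qpoch_inf q (q / \<alpha>) \<noteq> 0"
    "qpoch_inf q \<beta> \<noteq> 0" "qpoch_inf q (\<beta> / (\<alpha> * t)) \<noteq> 0" "qpoch_inf q (\<alpha> * t * q / \<beta>) \<noteq> 0"
    "qpoch_inf q y \<noteq> 0" "qpoch_inf q (\<gamma> * q / \<beta>) \<noteq> 0" "qpoch_inf q (e * q / \<beta>) \<noteq> 0"
    "qpoch_inf q (g * q / \<beta>) \<noteq> 0"
    using denom_inf by (auto simp: y_def)
  have fin: "qpoch q \<beta> n \<noteq> 0" "qpoch q \<delta> n \<noteq> 0" "qpoch q f n \<noteq> 0" "qpoch q h n \<noteq> 0" "qpoch q t n \<noteq> 0"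
    "qpoch q q n \<noteq> 0" "qpoch q (\<delta> * q / \<beta>) n \<noteq> 0" "qpoch q (f * q / \<beta>) n \<noteq> 0"
    "qpoch q (h * q / \<beta>) n \<noteq> 0" for n
    using denom_fin by auto
  have fin': "qpoch q y n \<noteq> 0" "qpoch q (\<gamma> * q / \<beta>) n \<noteq> 0" "qpoch q (e * q / \<beta>) n \<noteq> 0"
    "qpoch q (g * q / \<beta>) n \<noteq> 0" for n
    using inf qpoch_nonzero_if_inf(1)[OF norm_q] by auto
  have t_inf: "qpoch_inf q t \<noteq> 0"
    by (rule qpoch_tendsto(2)[OF norm_q fin(5)])

  (* Neither the numerators nor the denominators of Wg, We and Wc vanish, so these ratios can be
     cancelled from the 4phi3 series one at a time. *)
  have V4: "(\<lambda>n. V n * t ^ n * Wg n * We n * Wc n) summable_on UNIV"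
  proof -
    have "(\<lambda>n. V n * t ^ n * Wg n * We n * Wc n)
      = qhyp_term q [\<alpha>*q/\<beta>, \<gamma>*q/\<beta>, e*q/\<beta>, g*q/\<beta>] [\<delta>*q/\<beta>, f*q/\<beta>, h*q/\<beta>] t"
      by (simp add: fun_eq_iff qhyp_term_def qpochs_def V_def qcoeff_def Wg_def We_def Wc_def mult_ac)
    then show ?thesis
      using conv_4phi3 by (simp add: qhyp_converges_def abs_summable_summable)
  qed
  have V3: "(\<lambda>n. V n * t ^ n * Wg n * We n) summable_on UNIV"
    using summable_on_cancel_ratio[OF norm_q V4[unfolded Wc_def] fin'(2) fin(7)] .
  have V2: "(\<lambda>n. V n * t ^ n * Wg n) summable_on UNIV"
    using summable_on_cancel_ratio[OF norm_q V3[unfolded We_def] fin'(3) fin(8)] .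
  have V: "(\<lambda>n. V n * t ^ n) summable_on UNIV"
    using summable_on_cancel_ratio[OF norm_q V2[unfolded Wg_def] fin'(4) fin(9)] .

  have \<Phi>: "\<Phi> N = qpoch_inf q (y * q ^ (N + 1)) / qpoch_inf q (t * q ^ N)" for N
  proof -
    have "(\<lambda>n. V n * (t * q ^ N) ^ n) summable_on UNIV"
      using V norm_q by (intro psum_shrink_summable) (auto simp: norm_power power_le_one)
    from q_binomial[OF norm_q this[unfolded V_def]]
    have "qpoch_inf q (t * q ^ N) * \<Phi> N = qpoch_inf q (y * q ^ (N + 1))"
      by (simp add: \<Phi>_def V_def y_def mult_ac)
    then show ?thesis
      using qpoch_nonzero_if_inf(2)[OF norm_q t_inf, of N] by (simp add: nonzero_eq_divide_eq mult.commute)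
  qed
  have kernel: "qpoch q (t * q ^ p) m / qpoch q (\<alpha> * t * q ^ p / \<beta>) (m + 1) = \<kappa> p * \<Phi> (p + m)" for p m
    using qpoch_quotient_as_tails[OF norm_q t_inf inf(8), of p m]
    unfolding \<kappa>_def \<Phi> by (simp add: y_def)
  have \<kappa>: "\<kappa> N = \<kappa> 0 * (qpoch q y N / qpoch q t N)" for N
    unfolding \<kappa>_def using qpoch_inf_shift[OF norm_q t_inf, of N] qpoch_inf_shift[OF norm_q inf(8), of N]
    by simp
  have \<kappa>_nz: "\<kappa> N \<noteq> 0" for N
    unfolding \<kappa>_def using qpoch_nonzero_if_inf(2)[OF norm_q t_inf] qpoch_nonzero_if_inf(2)[OF norm_q inf(8)] by simp
  have ratio_lim: "(\<lambda>N. qpoch q y N / qpoch q t N) \<longlonglongrightarrow> qpoch_inf q y / qpoch_inf q t"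
    using t_inf by (intro tendsto_divide qpoch_tendsto(1) norm_q)
  have \<kappa>_lim: "\<kappa> \<longlonglongrightarrow> \<kappa> 0 * (qpoch_inf q y / qpoch_inf q t)"
    using tendsto_mult_left[OF ratio_lim, of "\<kappa> 0"] unfolding \<kappa>[symmetric] .
  obtain K where K: "norm (\<kappa> N) \<le> K" for N
    using convergent_imp_Bseq[OF convergentI[OF \<kappa>_lim]] by (auto simp: Bseq_def)

  have H2: "qhyp q [\<alpha>*q/\<beta>, g*q/\<beta>] [h*q/\<beta>] (t * q ^ N) = H2 N" for N
    unfolding qhyp_def H2_def psum_def
    by (rule infsum_cong) (simp add: qhyp_term_def qpochs_def V_def qcoeff_def Wg_def)
  have H3: "qhyp q [\<alpha>*q/\<beta>, e*q/\<beta>, g*q/\<beta>] [f*q/\<beta>, h*q/\<beta>] (t * q ^ N) = H3 N" for N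
    unfolding qhyp_def H3_def psum_def
    by (rule infsum_cong) (simp add: qhyp_term_def qpochs_def V_def qcoeff_def Wg_def We_def mult_ac)
  have H4: "qhyp q [\<alpha>*q/\<beta>, \<gamma>*q/\<beta>, e*q/\<beta>, g*q/\<beta>] [\<delta>*q/\<beta>, f*q/\<beta>, h*q/\<beta>] t = H4"
    unfolding qhyp_def H4_def psum_def
    by (rule infsum_cong) (simp add: qhyp_term_def qpochs_def V_def qcoeff_def Wg_def We_def Wc_def mult_ac)
  have VW2: "(\<lambda>n. V n * Wg n * t ^ n) summable_on UNIV"
    and VW3: "(\<lambda>n. V n * Wg n * We n * t ^ n) summable_on UNIV"
    using V2 V3 by (simp_all add: mult_ac)
  have start: "V 0 = 1" "Wg 0 = 1" "We 0 = 1"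
    by (simp_all add: V_def qcoeff_def Wg_def We_def mult_ac)
  have \<Phi>_lim: "\<Phi> \<longlonglongrightarrow> 1"
    using psum_tendsto[OF norm_q V] unfolding \<Phi>_def start .
  have H2_lim: "H2 \<longlonglongrightarrow> 1"
    using psum_tendsto[OF norm_q VW2] unfolding H2_def by (simp add: start)
  have H3_lim: "H3 \<longlonglongrightarrow> 1"
    using psum_tendsto[OF norm_q VW3] unfolding H3_def by (simp add: start)

  (* The quadruple series at j = k = 0, the triple series at k = 0 and the double series give the
     summability of the bare weights, since their remaining factors tend to nonzero limits. *)
  have A: "(\<lambda>(i, m). A (i + m) * g ^ i * (g * r) ^ m) summable_on {1..} \<times> UNIV"
  proof (rule pair_weights_summable[OF _ \<kappa>_lim _ \<kappa>_nz \<Phi>_lim])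
    have "(\<lambda>(p, j, k, m). qpoch q (h/g) p * g^p / qpoch q q p
               * (qpoch q (f/e) j * e^j / qpoch q q j
               * (qpoch q (\<delta>/\<gamma>) k * \<gamma>^k / qpoch q q k
               * (qpoch q (h*q^p/g) m * qpoch q (t*q^(p+k+j)) m
               / (qpoch q (q^(p+1)) m * qpoch q (\<alpha>*t*q^(p+k+j)/\<beta>) (m+1)) * (g*q/\<beta>)^m))))
          summable_on ({1..} \<times> UNIV \<times> UNIV \<times> UNIV)"
      using conv_quad by (rule abs_summable_summable)
    from summable_on_compose_inj[OF this, of "\<lambda>(p, m). (p, 0, 0, m)" "{1..} \<times> UNIV"]
    have "(\<lambda>(p, m). qpoch q (h/g) p * g^p / qpoch q q p
               * (qpoch q (h*q^p/g) m * qpoch q (t*q^p) m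
               / (qpoch q (q^(p+1)) m * qpoch q (\<alpha>*t*q^p/\<beta>) (m+1)) * (g*q/\<beta>)^m))
          summable_on ({1..} \<times> UNIV)"
      by (simp add: case_prod_unfold inj_on_def image_subset_iff)
    moreover have "qpoch q (h/g) p * g^p / qpoch q q p
               * (qpoch q (h*q^p/g) m * qpoch q (t*q^p) m
               / (qpoch q (q^(p+1)) m * qpoch q (\<alpha>*t*q^p/\<beta>) (m+1)) * (g*q/\<beta>)^m)
        = A (p + m) * g ^ p * (g * r) ^ m * (\<kappa> p * \<Phi> (p + m))" for p m
      unfolding A_def qcoeff_add kernel[symmetric] r_def by (simp add: mult_ac)
    ultimately show "(\<lambda>(p, m). A (p + m) * g ^ p * (g * r) ^ m * (\<kappa> p * \<Phi> (p + m))) summable_on {1..} \<times> UNIV"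
      by simp
  qed (use inf t_inf \<kappa>_nz in auto)
  have B: "(\<lambda>(i, m). B (i + m) * e ^ i * (e * r) ^ m) summable_on {1..} \<times> UNIV"
  proof (rule pair_weights_summable[OF _ ratio_lim _ _ H2_lim])
    have "(\<lambda>(p, k, j). qpochs q [f/e, \<alpha>*t/\<beta>] p * e^p / qpochs q [t, q] p
               * (qpochs q [\<delta>/\<gamma>, \<alpha>*t*q^p/\<beta>] k * \<gamma>^k / qpochs q [q, t*q^p] k
               * (qpoch q (f*q^p/e) j * (e*q/\<beta>)^j / qpoch q (q^(p+1)) j
               * qhyp q [\<alpha>*q/\<beta>, g*q/\<beta>] [h*q/\<beta>] (t*q^(p+k+j)))))
          summable_on ({1..} \<times> UNIV \<times> UNIV)"
      using conv_triple by (rule abs_summable_summable)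
    from summable_on_compose_inj[OF this, of "\<lambda>(p, j). (p, 0, j)" "{1..} \<times> UNIV"]
    have "(\<lambda>(p, j). qpochs q [f/e, \<alpha>*t/\<beta>] p * e^p / qpochs q [t, q] p
               * (qpoch q (f*q^p/e) j * (e*q/\<beta>)^j / qpoch q (q^(p+1)) j * H2 (p + j)))
          summable_on ({1..} \<times> UNIV)"
      by (simp add: case_prod_unfold inj_on_def image_subset_iff qpochs_def H2)
    moreover have "qpochs q [f/e, \<alpha>*t/\<beta>] p * e^p / qpochs q [t, q] p
               * (qpoch q (f*q^p/e) j * (e*q/\<beta>)^j / qpoch q (q^(p+1)) j * H2 (p + j))
        = B (p + j) * e ^ p * (e * r) ^ j * (qpoch q y p / qpoch q t p * H2 (p + j))" for p j
      unfolding B_def qcoeff_add r_def by (simp add: qpochs_def y_def mult_ac)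
    ultimately show "(\<lambda>(p, j). B (p + j) * e ^ p * (e * r) ^ j * (qpoch q y p / qpoch q t p * H2 (p + j)))
        summable_on {1..} \<times> UNIV"
      by simp
  qed (use inf t_inf fin fin' in auto)
  have T3_summable: "(\<lambda>(p, k). qpochs q [\<delta>/\<gamma>, \<alpha>*t/\<beta>] p * \<gamma>^p / qpochs q [t, q] p
               * (qpoch q (\<delta>*q^p/\<gamma>) k * (\<gamma>*q/\<beta>)^k / qpoch q (q^(p+1)) k * H3 (p + k)))
          summable_on UNIV \<times> UNIV"
    using abs_summable_summable[OF conv_double] unfolding H3 .
  have C: "(\<lambda>(i, m). C (i + m) * \<gamma> ^ i * (\<gamma> * r) ^ m) summable_on {1..} \<times> UNIV"
  proof (rule pair_weights_summable[OF _ ratio_lim _ _ H3_lim])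
    have "(\<lambda>(p, k). qpochs q [\<delta>/\<gamma>, \<alpha>*t/\<beta>] p * \<gamma>^p / qpochs q [t, q] p
               * (qpoch q (\<delta>*q^p/\<gamma>) k * (\<gamma>*q/\<beta>)^k / qpoch q (q^(p+1)) k * H3 (p + k)))
          summable_on {1..} \<times> UNIV"
      using T3_summable by (rule summable_on_subset_banach) auto
    moreover have "qpochs q [\<delta>/\<gamma>, \<alpha>*t/\<beta>] p * \<gamma>^p / qpochs q [t, q] p
               * (qpoch q (\<delta>*q^p/\<gamma>) k * (\<gamma>*q/\<beta>)^k / qpoch q (q^(p+1)) k * H3 (p + k))
        = C (p + k) * \<gamma> ^ p * (\<gamma> * r) ^ k * (qpoch q y p / qpoch q t p * H3 (p + k))" for p k
      unfolding C_def qcoeff_add r_def by (simp add: qpochs_def y_def mult_ac)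
    ultimately show "(\<lambda>(p, k). C (p + k) * \<gamma> ^ p * (\<gamma> * r) ^ k * (qpoch q y p / qpoch q t p * H3 (p + k)))
        summable_on {1..} \<times> UNIV"
      by simp
  qed (use inf t_inf fin fin' in auto)
  note slA = pair_weights_slices[OF A nonzero(6)]
  note slB = pair_weights_slices[OF B nonzero(5)]
  note slC = pair_weights_slices[OF C nonzero(4)]

  (* The expansions of (g)_n / (h)_n, (e)_n / (f)_n and (gamma)_n / (delta)_n in powers of q ^ n
     are instances of the q-binomial theorem. *)
  have g_inf: "qpoch_inf q g \<noteq> 0" and e_inf: "qpoch_inf q e \<noteq> 0" and \<gamma>_inf: "qpoch_inf q \<gamma> \<noteq> 0"
    using q_binomial_nonzero[OF norm_q slA(1)[unfolded A_def]] q_binomial_nonzero[OF norm_q slB(1)[unfolded B_def]]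
      q_binomial_nonzero[OF norm_q slC(1)[unfolded C_def]] inf nonzero by auto
  have PA: "psum A (g * q ^ n) = qpoch_inf q h / qpoch_inf q g * (qpoch q g n / qpoch q h n)" for n
    using q_binomial_shifted[OF norm_q slA(1)[unfolded A_def] g_inf] fin(4) nonzero by (simp add: A_def)
  have PB: "psum B (e * q ^ n) = qpoch_inf q f / qpoch_inf q e * (qpoch q e n / qpoch q f n)" for n
    using q_binomial_shifted[OF norm_q slB(1)[unfolded B_def] e_inf] fin(3) nonzero by (simp add: B_def)
  have PC: "psum C (\<gamma> * q ^ n) = qpoch_inf q \<delta> / qpoch_inf q \<gamma> * (qpoch q \<gamma> n / qpoch q \<delta> n)" for n
    using q_binomial_shifted[OF norm_q slC(1)[unfolded C_def] \<gamma>_inf] fin(2) nonzero by (simp add: C_def)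
  have QA: "psum A (g * r * q ^ n) = \<rho>g * Wg n" for n
    using q_binomial_shifted[OF norm_q slA(2)[unfolded A_def]] inf fin(9) nonzero
    by (simp add: A_def r_def \<rho>g_def Wg_def)
  have QB: "psum B (e * r * q ^ n) = \<rho>e * We n" for n
    using q_binomial_shifted[OF norm_q slB(2)[unfolded B_def]] inf fin(8) nonzero
    by (simp add: B_def r_def \<rho>e_def We_def)
  have QC: "psum C (\<gamma> * r * q ^ n) = \<rho>c * Wc n" for n
    using q_binomial_shifted[OF norm_q slC(2)[unfolded C_def]] inf fin(7) nonzero
    by (simp add: C_def r_def \<rho>c_def Wc_def)

  have u: "(\<lambda>n. u n * t ^ n) summable_on UNIV"
  proof -
    have "(\<lambda>n. qpochs q [\<alpha>, \<gamma>, e, g] n / qpochs q [\<beta>, \<delta>, f, h] n * t^n) summable_on UNIV"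
      using conv_lhs by (rule abs_summable_summable)
    then have s: "(\<lambda>n. u n * t ^ n * (qpoch q \<gamma> n / qpoch q \<delta> n) * (qpoch q e n / qpoch q f n)
        * (qpoch q g n / qpoch q h n)) summable_on UNIV"
      by (simp add: qpochs_def u_def qratio_def mult_ac)
    note nz = qpoch_nonzero_if_inf(1)[OF norm_q]
    from summable_on_cancel_ratio[OF norm_q s nz[OF g_inf] fin(4)]
    have s: "(\<lambda>n. u n * t ^ n * (qpoch q \<gamma> n / qpoch q \<delta> n) * (qpoch q e n / qpoch q f n)) summable_on UNIV" .
    from summable_on_cancel_ratio[OF norm_q s nz[OF e_inf] fin(3)]
    have s: "(\<lambda>n. u n * t ^ n * (qpoch q \<gamma> n / qpoch q \<delta> n)) summable_on UNIV" .
    from summable_on_cancel_ratio[OF norm_q s nz[OF \<gamma>_inf] fin(2)]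
    show ?thesis .
  qed
  (* Phi never vanishes, and E is the quotient of psum u and Phi. *)
  define E where "E N = psum u (t * q ^ N) * (qpoch_inf q (t * q ^ N) / qpoch_inf q (y * q ^ (N + 1)))" for N
  have E: "E (Suc N) = r * E N + (1 - q / \<beta>) * \<kappa> (Suc N)" for N
    using quotient_recursion[OF norm_q nonzero(3) fin(1) t_inf inf(8)[unfolded y_def] u[unfolded u_def], of N]
    by (simp add: E_def u_def y_def \<kappa>_def r_def)
  have factor: "psum u (t * q ^ N) = E N * psum V (t * q ^ N)" for N
    using \<Phi>[of N] qpoch_nonzero_if_inf(2)[OF norm_q t_inf, of N] qpoch_nonzero_if_inf(2)[OF norm_q inf(8), of "N + 1"]
    by (simp add: E_def \<Phi>_def)

  (* T3, T4 and T5 are the summands of the double, the triple and the quadruple sum. *)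
  define T3 where "T3 p = qpochs q [\<delta>/\<gamma>, \<alpha>*t/\<beta>] p * \<gamma>^p / qpochs q [t, q] p
      * (\<Sum>\<^sub>\<infinity>k. qpoch q (\<delta>*q^p/\<gamma>) k * (\<gamma>*q/\<beta>)^k / qpoch q (q^(p+1)) k * H3 (p + k))" for p
  define T4 where "T4 p = qpochs q [f/e, \<alpha>*t/\<beta>] p * e^p / qpochs q [t, q] p
      * (\<Sum>\<^sub>\<infinity>k. qpochs q [\<delta>/\<gamma>, \<alpha>*t*q^p/\<beta>] k * \<gamma>^k / qpochs q [q, t*q^p] k
        * (\<Sum>\<^sub>\<infinity>j. qpoch q (f*q^p/e) j * (e*q/\<beta>)^j / qpoch q (q^(p+1)) j * H2 (p + k + j)))" for p
  define T5 where "T5 p = qpoch q (h/g) p * g^p / qpoch q q p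
      * (\<Sum>\<^sub>\<infinity>j. qpoch q (f/e) j * e^j / qpoch q q j
        * (\<Sum>\<^sub>\<infinity>k. qpoch q (\<delta>/\<gamma>) k * \<gamma>^k / qpoch q q k
          * (\<Sum>\<^sub>\<infinity>m. qpoch q (h*q^p/g) m * qpoch q (t*q^(p+k+j)) m
              / (qpoch q (q^(p+1)) m * qpoch q (\<alpha>*t*q^(p+k+j)/\<beta>) (m+1)) * (g*q/\<beta>)^m)))" for p

  define V1 where "V1 n = V n * psum A (g * r * q ^ n)" for n
  define V2' where "V2' n = V1 n * psum B (e * r * q ^ n)" for n
  define V3' where "V3' n = V2' n * psum C (\<gamma> * r * q ^ n)" for n
  have V1_psum: "psum V1 (t * q ^ N) = \<rho>g * H2 N" for N
    unfolding H2_def psum_cmult[symmetric] V1_def QA by (simp only: mult_ac)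
  have V2_psum: "psum V2' (t * q ^ N) = \<rho>g * \<rho>e * H3 N" for N
    unfolding H3_def psum_cmult[symmetric] V2'_def V1_def QA QB by (simp only: mult_ac)
  have V3_psum: "psum V3' t = \<rho>g * \<rho>e * \<rho>c * H4"
    unfolding H4_def psum_cmult[symmetric] V3'_def V2'_def V1_def QA QB QC by (simp only: mult_ac)

  have ex3: "excursion C \<gamma> r \<kappa> (\<lambda>N. psum V2' (t * q ^ N)) 0 p = \<kappa> 0 * \<rho>g * \<rho>e * T3 p" for p
  proof -
    have "C (p + m) * \<gamma> ^ p * (\<gamma> * r) ^ m * (\<kappa> (0 + p) * psum V2' (t * q ^ (0 + p + m)))
        = \<kappa> 0 * \<rho>g * \<rho>e * (qpochs q [\<delta>/\<gamma>, \<alpha>*t/\<beta>] p * \<gamma>^p / qpochs q [t, q] p)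
          * (qpoch q (\<delta>*q^p/\<gamma>) m * (\<gamma>*q/\<beta>)^m / qpoch q (q^(p+1)) m * H3 (p + m))" for m
      unfolding C_def qcoeff_add r_def V2_psum \<kappa>[of "0 + p"] by (simp add: qpochs_def y_def mult_ac)
    then show ?thesis
      unfolding excursion_def T3_def by (simp only: infsum_cmult_right' mult.assoc)
  qed
  have ex4: "(\<Sum>\<^sub>\<infinity>k. C k * \<gamma> ^ k * excursion B e r \<kappa> (\<lambda>N. psum V1 (t * q ^ N)) k p) = \<kappa> 0 * \<rho>g * T4 p" for p
  proof -
    define J where "J k = (\<Sum>\<^sub>\<infinity>j. qpoch q (f*q^p/e) j * (e*q/\<beta>)^j / qpoch q (q^(p+1)) j * H2 (p + k + j))" for k
    define P where "P = \<kappa> 0 * \<rho>g * (qpochs q [f/e, \<alpha>*t/\<beta>] p * e^p / qpochs q [t, q] p)"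
    have \<kappa>_add: "\<kappa> (k + p) = \<kappa> 0 * (qpoch q y p * qpoch q (y * q ^ p) k / (qpoch q t p * qpoch q (t * q ^ p) k))" for k
      using \<kappa>[of "p + k"] unfolding qpoch_add by (simp only: add.commute[of p k])
    have summand: "B (p + j) * e ^ p * (e * r) ^ j * (\<kappa> (k + p) * psum V1 (t * q ^ (k + p + j)))
        = P * (qpoch q (y * q ^ p) k / qpoch q (t * q ^ p) k)
          * (qpoch q (f*q^p/e) j * (e*q/\<beta>)^j / qpoch q (q^(p+1)) j * H2 (p + k + j))" for j k
      unfolding B_def qcoeff_add r_def V1_psum \<kappa>_add P_def
      by (simp add: qpochs_def y_def add.commute[of k p] mult_ac)
    have ex: "excursion B e r \<kappa> (\<lambda>N. psum V1 (t * q ^ N)) k p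
        = P * (qpoch q (y * q ^ p) k / qpoch q (t * q ^ p) k) * J k" for k
      unfolding excursion_def summand J_def infsum_cmult_right' ..
    have "C k * \<gamma> ^ k * excursion B e r \<kappa> (\<lambda>N. psum V1 (t * q ^ N)) k p
        = P * (qpochs q [\<delta>/\<gamma>, \<alpha>*t*q^p/\<beta>] k * \<gamma>^k / qpochs q [q, t*q^p] k * J k)" for k
      unfolding ex C_def qcoeff_def by (simp add: qpochs_def y_def mult_ac)
    then show ?thesis
      unfolding T4_def J_def[symmetric] by (simp only: infsum_cmult_right' P_def mult.assoc)
  qed
  have ex5: "(\<Sum>\<^sub>\<infinity>j. B j * e ^ j * (\<Sum>\<^sub>\<infinity>k. C k * \<gamma> ^ k
        * excursion A g r \<kappa> (\<lambda>N. psum V (t * q ^ N)) (k + j) p)) = T5 p" for p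
  proof -
    define J where "J j k = (\<Sum>\<^sub>\<infinity>m. qpoch q (h*q^p/g) m * qpoch q (t*q^(p+k+j)) m
        / (qpoch q (q^(p+1)) m * qpoch q (\<alpha>*t*q^(p+k+j)/\<beta>) (m+1)) * (g*q/\<beta>)^m)" for j k
    define P where "P = qpoch q (h/g) p * g^p / qpoch q q p"
    have summand: "A (p + m) * g ^ p * (g * r) ^ m * (\<kappa> (k + j + p) * psum V (t * q ^ (k + j + p + m)))
        = P * (qpoch q (h*q^p/g) m * qpoch q (t*q^(p+k+j)) m
        / (qpoch q (q^(p+1)) m * qpoch q (\<alpha>*t*q^(p+k+j)/\<beta>) (m+1)) * (g*q/\<beta>)^m)" for j k m
    proof -
      have "k + j + p = p + k + j"
        by simp
      then show ?thesis
        unfolding A_def qcoeff_add r_def \<Phi>_def[symmetric] P_def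
        by (simp only: kernel[symmetric]) (simp add: mult_ac)
    qed
    have ex: "excursion A g r \<kappa> (\<lambda>N. psum V (t * q ^ N)) (k + j) p = P * J j k" for j k
      unfolding excursion_def summand J_def infsum_cmult_right' ..
    define I where "I j = (\<Sum>\<^sub>\<infinity>k. qpoch q (\<delta>/\<gamma>) k * \<gamma>^k / qpoch q q k * J j k)" for j
    have inner: "(\<Sum>\<^sub>\<infinity>k. C k * \<gamma> ^ k * (P * J j k)) = P * I j" for j
      unfolding I_def infsum_cmult_right'[symmetric] C_def qcoeff_def by (rule infsum_cong) (simp add: mult_ac)
    have "(\<Sum>\<^sub>\<infinity>j. B j * e ^ j * (\<Sum>\<^sub>\<infinity>k. C k * \<gamma> ^ k * (P * J j k)))
        = P * (\<Sum>\<^sub>\<infinity>j. qpoch q (f/e) j * e^j / qpoch q q j * I j)"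
      unfolding inner infsum_cmult_right'[symmetric] B_def qcoeff_def by (rule infsum_cong) (simp add: mult_ac)
    then show ?thesis
      unfolding ex T5_def J_def[symmetric] I_def[symmetric] P_def[symmetric] .
  qed

  (* The double series of the statement starts at p = 0. Its first term is a multiple of the
     4phi3 series and cancels the summand -1 next to the 2phi1 series. *)
  have T3_split: "(\<Sum>\<^sub>\<infinity>p. T3 p) = \<rho>c * H4 + (\<Sum>\<^sub>\<infinity>p\<in>{1..}. T3 p)"
  proof -
    have "T3 summable_on UNIV"
      using summable_on_Sigma_banach[OF T3_summable] unfolding T3_def[abs_def] infsum_cmult_right' .
    then have "(\<Sum>\<^sub>\<infinity>p. T3 p) = T3 0 + (\<Sum>\<^sub>\<infinity>p\<in>{1..}. T3 p)"
      by (rule infsum_nat_split_first(3))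
    moreover have "T3 0 = \<rho>c * H4"
    proof -
      have "T3 0 = (\<Sum>\<^sub>\<infinity>k. C k * (\<gamma> * r) ^ k * psum (\<lambda>n. V n * Wg n * We n) (t * q ^ (0 + k)))"
        by (simp add: T3_def qpochs_def C_def qcoeff_def r_def H3_def)
      also have "\<dots> = psum (\<lambda>n. V n * Wg n * We n * psum C (\<gamma> * r * q ^ n)) (t * q ^ 0)"
        by (rule psum_of_psums(1)[OF norm_q slC(2) VW3])
      also have "\<dots> = \<rho>c * H4"
        unfolding QC H4_def psum_cmult[symmetric] by (simp add: mult_ac)
      finally show ?thesis .
    qed
    ultimately show ?thesis by simp
  qed

  define U where "U n = u n * psum A (g * q ^ n) * psum B (e * q ^ n) * psum C (\<gamma> * q ^ n)" for n
  have expansion: "psum U t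
      = E 0 * (\<rho>g * \<rho>e * \<rho>c * H4) + (1 - q / \<beta>) * (\<kappa> 0 * \<rho>g * \<rho>e * (\<Sum>\<^sub>\<infinity>p\<in>{1..}. T3 p)
          + \<kappa> 0 * \<rho>g * (\<Sum>\<^sub>\<infinity>p\<in>{1..}. T4 p) + (\<Sum>\<^sub>\<infinity>p\<in>{1..}. T5 p))"
    using threefold_expansion[where E = E and \<kappa> = \<kappa>, OF norm_q nonzero(6,5,4) u V A B C factor E K]
    unfolding V1_def[symmetric] V2'_def[symmetric] V3'_def[symmetric] V3_psum ex3 ex4 ex5 infsum_cmult_right' U_def[symmetric] .
  define G where "G = qpoch_inf q g * qpoch_inf q e * qpoch_inf q \<gamma> / (qpoch_inf q h * qpoch_inf q f * qpoch_inf q \<delta>)"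
  have lhs: "(\<Sum>\<^sub>\<infinity>n. qpochs q [\<alpha>, \<gamma>, e, g] n / qpochs q [\<beta>, \<delta>, f, h] n * t^n)
      = G * psum U t"
    unfolding psum_def[of U] infsum_cmult_right'[symmetric]
  proof (rule infsum_cong)
    fix n
    show "qpochs q [\<alpha>, \<gamma>, e, g] n / qpochs q [\<beta>, \<delta>, f, h] n * t^n
      = G * (U n * t ^ n)"
      unfolding U_def PA PB PC G_def u_def qratio_def using inf(1-3) g_inf e_inf \<gamma>_inf by (simp add: qpochs_def mult_ac)
  qed

  define S where "S = qhyp q [q, q/t] [\<beta>*q/(\<alpha>*t)] (q/\<alpha>)"
  have S: "S = psum (qratio q (q / t) (\<beta> * q / (\<alpha> * t))) (q / \<alpha>)"
    unfolding S_def qhyp_def psum_def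
    by (rule infsum_cong) (use fin(6) in \<open>simp add: qhyp_term_def qpochs_def qratio_def\<close>)
  have S_summable: "(\<lambda>n. qratio q (q / t) (\<beta> * q / (\<alpha> * t)) n * (q / \<alpha>) ^ n) summable_on UNIV"
  proof -
    have "(\<lambda>n. qratio q (q / t) (\<beta> * q / (\<alpha> * t)) n * (q / \<alpha>) ^ n) = qhyp_term q [q, q/t] [\<beta>*q/(\<alpha>*t)] (q/\<alpha>)"
      using fin(6) by (simp add: fun_eq_iff qhyp_term_def qpochs_def qratio_def)
    then show ?thesis
      using conv_2phi1 by (simp add: qhyp_converges_def abs_summable_summable)
  qed
  define R where "R = qpoch_inf q (\<beta> / \<alpha>) * qpoch_inf q q * qpoch_inf q (\<alpha> * t) * qpoch_inf q (q / (\<alpha> * t))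
           / (qpoch_inf q (q / \<alpha>) * qpoch_inf q \<beta> * qpoch_inf q (\<beta> / (\<alpha> * t)) * qpoch_inf q (\<alpha> * t * q / \<beta>))"
  have E0: "E 0 = R + (1 - q / \<beta>) * \<kappa> 0 * S"
  proof -
    have "psum u t = R * qpoch_inf q (\<alpha> * t * q / \<beta>) / qpoch_inf q t + (\<beta> - q) / (\<beta> - \<alpha> * t) * S"
      unfolding u_def S R_def
      using three_term_sum[OF norm_q nonzero(1,2,7) inf(5,6,4) t_inf u[unfolded u_def] S_summable] inf(7)
      by simp
    moreover have "qpoch_inf q y = (1 - y) * qpoch_inf q (\<alpha> * t * q / \<beta>)"
      using qpoch_inf_split_first[OF norm_q, of y] by (simp add: y_def)
    moreover have "(\<beta> - q) / (\<beta> - \<alpha> * t) = (1 - q / \<beta>) / (1 - y)"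
      using nonzero(3) by (simp add: y_def divide_simps)
    moreover have "E 0 = psum u t * (qpoch_inf q t / qpoch_inf q (\<alpha> * t * q / \<beta>))"
      by (simp add: E_def y_def)
    moreover have "(R * Y / T + k / z * S) * (T / Y) = R + k * (T / (z * Y)) * S"
      if "Y \<noteq> 0" "T \<noteq> 0" for k z T Y :: complex
    proof -
      have "R * Y / T * (T / Y) = R"
        using that by simp
      then show ?thesis
        unfolding distrib_right by simp
    qed
    ultimately show ?thesis
      unfolding \<kappa>_def using inf(7) t_inf by simp
  qed

  define X3 where "X3 = (\<Sum>\<^sub>\<infinity>p\<in>{1..}. T3 p)"
  define X4 where "X4 = (\<Sum>\<^sub>\<infinity>p\<in>{1..}. T4 p)"
  define X5 where "X5 = (\<Sum>\<^sub>\<infinity>p\<in>{1..}. T5 p)"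
  have pre1: "qpochs_inf q [g, e, \<gamma>, \<beta>/\<alpha>, q, \<alpha>*t, q/(\<alpha>*t), \<delta>*q/\<beta>, f*q/\<beta>, h*q/\<beta>]
         / qpochs_inf q [h, f, \<delta>, q/\<alpha>, \<beta>, \<beta>/(\<alpha>*t), \<alpha>*t*q/\<beta>, \<gamma>*q/\<beta>, e*q/\<beta>, g*q/\<beta>]
      = G * R * \<rho>g * \<rho>e * \<rho>c"
    by (simp add: qpochs_inf_def G_def R_def \<rho>g_def \<rho>e_def \<rho>c_def mult_ac)
  have pre2: "qpochs_inf q [g, e, \<gamma>, t, \<delta>*q/\<beta>, f*q/\<beta>, h*q/\<beta>]
            / qpochs_inf q [h, f, \<delta>, \<alpha>*t/\<beta>, \<gamma>*q/\<beta>, e*q/\<beta>, g*q/\<beta>] = G * \<kappa> 0 * \<rho>g * \<rho>e * \<rho>c"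
    by (simp add: qpochs_inf_def G_def \<kappa>_def y_def \<rho>g_def \<rho>e_def \<rho>c_def mult_ac)
  have pre3: "qpochs_inf q [g, e, \<gamma>, t, f*q/\<beta>, h*q/\<beta>]
            / qpochs_inf q [h, f, \<delta>, \<alpha>*t/\<beta>, e*q/\<beta>, g*q/\<beta>] = G * \<kappa> 0 * \<rho>g * \<rho>e"
    by (simp add: qpochs_inf_def G_def \<kappa>_def y_def \<rho>g_def \<rho>e_def mult_ac)
  have pre4: "qpochs_inf q [g, e, \<gamma>, t, h*q/\<beta>] / qpochs_inf q [h, f, \<delta>, \<alpha>*t/\<beta>, g*q/\<beta>] = G * \<kappa> 0 * \<rho>g"
    by (simp add: qpochs_inf_def G_def \<kappa>_def y_def \<rho>g_def mult_ac)
  have pre5: "qpochs_inf q [g, e, \<gamma>] / qpochs_inf q [h, f, \<delta>] = G"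
    by (simp add: qpochs_inf_def G_def mult_ac)
  have "G * ((R + c * \<kappa> 0 * S) * (\<rho>g * \<rho>e * \<rho>c * H4)
        + c * (\<kappa> 0 * \<rho>g * \<rho>e * X3 + \<kappa> 0 * \<rho>g * X4 + X5))
      = G * R * \<rho>g * \<rho>e * \<rho>c * H4 + c * (G * \<kappa> 0 * \<rho>g * \<rho>e * \<rho>c) * H4 * (S - 1)
        + c * (G * \<kappa> 0 * \<rho>g * \<rho>e) * (\<rho>c * H4 + X3)
        + c * (G * \<kappa> 0 * \<rho>g) * X4 + c * G * X5" for c
    by (simp add: algebra_simps)
  from this[of "1 - q / \<beta>"] show ?thesis
    unfolding lhs expansion E0 pre1 pre2 pre3 pre4 pre5 H2 H3 H4 S_def[symmetric]
      T3_def[symmetric] T4_def[symmetric] T5_def[symmetric] T3_split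
      X3_def[symmetric] X4_def[symmetric] X5_def[symmetric] .
qed

end
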